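(* Let $N,M\in\mathbb{N}$, let $I,J$ be non-empty sets, let $\mathfrak{d}=(\mathfrak{d}_1,\ldots,\mathfrak{d}_N)\colon I\to\mathbb{N}^N$ be an $N$-fold dimension mapping on $I$, let $\mathsf{d}=(\mathsf{d}_1,\ldots,\mathsf{d}_M)\colon J\to\mathbb{N}^M$ be an $M$-fold dimension mapping on $J$, let $\kappa,r_0,r_1,\ldots,r_N,\mathbf{r}_1,\ldots,\mathbf{r}_M,\alpha_1,\ldots,\alpha_M,\beta_1,\ldots,\beta_N,\gamma_1,\ldots,\gamma_M,R_1,\ldots,R_N,\mathbf{R}_1,\ldots,\mathbf{R}_M\in[0,\infty)$, $\rho\in[0,1)$, $(\mathfrak{n}_j)_{j\in J}\subseteq\{2,3,4,\ldots\}$, $A=\{(i,j,k)\in I\times J\times\mathbb{N}\colon k\le\mathfrak{n}_j\}$, $B=\{(i,j,k)\in A\colon k\le\mathfrak{n}_j-1\}$, $(L_i^{j,k})_{(i,j,k)\in A}\subseteq(0,\infty]$, $G=(G_{i,\varepsilon}^{j,k})_{(i,j,k,\varepsilon)\in B\times(0,1]}\subseteq(0,\infty]$, $H=(H_{i,\varepsilon}^{j,k})_{(i,j,k,\varepsilon)\in B\times(0,1]}\subseteq(0,\infty]$, $a\in C(\mathbb{R},\mathbb{R})$ satisfy for all $i\in\{1,\ldots,N\}$, $j\in\{1,\ldots,M\}$ that $$R_i=2r_i+\tfrac{2r_0\beta_i}{1-\rho}\qquad\text{and}\qquad\mathbf{R}_j=2\mathbf{r}_j+\alpha_j+\tfrac{2r_0((\kappa+1)\alpha_j+\gamma_j)}{1-\rho}.$$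 Assume $$\left[\sup_{(i,j,k)\in A}\sup_{\varepsilon\in(0,1]}\frac{\big[\prod_{l=k+1}^{\mathfrak{n}_j}L_i^{j,l}\big]\Big[\max\!\big(\{H_{i,\varepsilon}^{j,l}\colon l\in\mathbb{N}\cap(0,k)\}\cup\{1\}\big)\prod_{l=1}^{k-1}\max\{G_{i,\varepsilon}^{j,l},1\}\Big]^\kappa}{\varepsilon^{-\rho}\big[\prod_{l=1}^N|\mathfrak{d}_l(i)|^{\beta_l}\big]\big[\prod_{l=1}^M|\mathsf{d}_l(j)|^{\gamma_l}\big]}\right]+\sup_{j\in J}\frac{\mathfrak{n}_j}{\prod_{l=1}^M|\mathsf{d}_l(j)|^{\alpha_l}}<\infty.$$ Let $\mathfrak{w}\colon[0,\infty)\to[0,\infty)$, $\mathfrak{I}\colon A\to\mathbb{N}$, and $\mathfrak{O}\colon A\to\mathbb{N}$ satisfy for all $v\in[0,\infty)$, $(i,j,k)\in B$ that $\mathfrak{w}(v)=(1+v^\kappa)^{-1}$ and $\mathfrak{O}(i,j,k)=\mathfrak{I}(i,j,k+1)$. For every $j\in J$, $k\in\{1,\ldots,\mathfrak{n}_j\}$ let $f^{j,k}=(f_i^{j,k})_{i\in I}$ be a function family on $I$ which satisfies for all $i\in I$, $x,y\in\mathbb{R}^{\mathfrak{I}(i,j,k)}$ that $f_i^{j,k}\in C(\mathbb{R}^{\mathfrak{I}(i,j,k)},\mathbb{R}^{\mathfrak{O}(i,j,k)})$ and $\|f_i^{j,k}(x)-f_i^{j,k}(y)\|\le L_i^{j,k}\|x-y\|$.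 Assume $$\big(I\times J\ni(i,j)\mapsto f_i^{j,\mathfrak{n}_j}\big)\in\mathcal{W}_{a,\mathfrak{w},\infty,\infty}^{r_0,r_1,\ldots,r_N,\mathbf{r}_1,\ldots,\mathbf{r}_M}(I\times J,\mathfrak{d}\otimes\mathsf{d})$$ and $$\big(B\ni(i,j,k)\mapsto f_i^{j,k}\big)\in\mathcal{W}_{a,\mathfrak{w},G,H}^{r_0,r_1,\ldots,r_N,\mathbf{r}_1,\ldots,\mathbf{r}_M,0}\big(B,(\mathfrak{d}\otimes\mathsf{d}\otimes\mathrm{id}_{\mathbb{N}})|_B\big).$$ Then the function family on $I\times J$ given by composition satisfies $$\Big(I\times J\ni(i,j)\mapsto f_i^{j,\mathfrak{n}_j}\circ f_i^{j,\mathfrak{n}_j-1}\circ\cdots\circ f_i^{j,1}\Big)\in\mathcal{W}_{a,\mathfrak{w},\infty,\infty}^{\frac{2r_0}{1-\rho},R_1,\ldots,R_N,\mathbf{R}_1,\ldots,\mathbf{R}_M}(I\times J,\mathfrak{d}\otimes\mathsf{d}).$$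
   Context: $\mathbb{N}=\{1,2,3,\ldots\}$ and $\|\cdot\|$ is the Euclidean norm on every $\mathbb{R}^d$. Empty products equal $1$; $0\cdot\infty=0$ in the Lipschitz bound (so it is vacuous where $L_i^{j,k}=\infty$); $\infty^\kappa=\infty$ for $\kappa>0$, $\infty^0=1$, and $0^0=1$. ANNs: $\mathscr{N} = \bigcup_{L\in\mathbb{N}}\bigcup_{l_0,\ldots,l_L\in\mathbb{N}} \left(\times_{k=1}^L (\mathbb{R}^{l_k\times l_{k-1}}\times\mathbb{R}^{l_k})\right)$. For $\Phi=((W_1,B_1),\ldots,(W_L,B_L)) \in \times_{k=1}^L (\mathbb{R}^{l_k\times l_{k-1}}\times\mathbb{R}^{l_k})$: $\mathcal{P}(\Phi)=\sum_{k=1}^L l_k(l_{k-1}+1)$, and for $a\in C(\mathbb{R},\mathbb{R})$ the realization $\mathcal{R}_a(\Phi)\in C(\mathbb{R}^{l_0},\mathbb{R}^{l_L})$ is $(\mathcal{R}_a(\Phi))(x_0)=W_Lx_{L-1}+B_L$, where for $0<k<L$ the vector $x_k$ is obtained by applying $a$ componentwise to $W_kx_{k-1}+B_k$. A function family on a non-empty set $I$ is a map $f=(f_i)_{i\in I}\colon I\to\bigcup_{k,l\in\mathbb{N}}C(\mathbb{R}^k,\mathbb{R}^l)$. An $N$-fold dimension mapping on $I$ is a function $\mathfrak{d}=(\mathfrak{d}_1,\ldots,\mathfrak{d}_N)\colon I\to\mathbb{N}^N$. For an $N$-fold dimension mapping $\mathfrak{d}$ on $I$ and an $M$-fold dimension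 mapping $\mathsf{d}$ on $J$, $\mathfrak{d}\otimes\mathsf{d}$ is the $(N+M)$-fold dimension mapping on $I\times J$ with $(\mathfrak{d}\otimes\mathsf{d})(i,j)=(\mathfrak{d}_1(i),\ldots,\mathfrak{d}_N(i),\mathsf{d}_1(j),\ldots,\mathsf{d}_M(j))$; similarly $(\mathfrak{d}\otimes\mathsf{d}\otimes\mathrm{id}_{\mathbb{N}})(i,j,k)=(\mathfrak{d}_1(i),\ldots,\mathfrak{d}_N(i),\mathsf{d}_1(j),\ldots,\mathsf{d}_M(j),k)$, and $|_B$ denotes restriction to $B$. Approximation spaces: for an $N$-fold dimension mapping $\mathfrak{d}$ on $I$, $r_0,\ldots,r_N\in\mathbb{R}$, $a\in C(\mathbb{R},\mathbb{R})$, $G=(G_{i,\varepsilon})_{(i,\varepsilon)\in I\times(0,1]}\subseteq(0,\infty]$, $H=(H_{i,\varepsilon})_{(i,\varepsilon)\in I\times(0,1]}\subseteq(0,\infty]$, and $\mathfrak{w}\colon[0,\infty)\to[0,\infty)$, the set $\mathcal{W}_{a,\mathfrak{w},G,H}^{r_0,r_1,\ldots,r_N}(I,\mathfrak{d})$ consists of all function families $f=(f_i)_{i\in I}$ on $I$ for which there exists $K\in\mathbb{R}$ such that for all $i\in I$, $\varepsilon\in(0,1]$ there exist $\Phi\in\mathscr{N}$ and $m,n\in\mathbb{N}$ such that for all $x\in\mathbb{R}^m$: $\{f_i,\mathcal{R}_a(\Phi)\}\subseteq C(\mathbb{R}^m,\mathbb{R}^n)$, $\mathcal{P}(\Phi)\le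 K\varepsilon^{-r_0}\prod_{l=1}^N|\mathfrak{d}_l(i)|^{r_l}$, $\mathfrak{w}(\|x\|)\|f_i(x)-(\mathcal{R}_a(\Phi))(x)\|\le\varepsilon$, and $\|(\mathcal{R}_a(\Phi))(x)\|\le G_{i,\varepsilon}(H_{i,\varepsilon}+\|x\|)$. In $\mathcal{W}_{a,\mathfrak{w},\infty,\infty}^{\ldots}$ both $G$ and $H$ are constantly $\infty$, i.e., the last condition is dropped. In the space over the index set $B$, the entry of $G$ (resp. $H$) belonging to the index $(i,j,k)\in B$ and $\varepsilon$ is $G_{i,\varepsilon}^{j,k}$ (resp. $H_{i,\varepsilon}^{j,k}$). *)

theory Defs
  imports
    "Jordan_Normal_Form.Matrix"
    "HOL-Library.Extended_Nonnegative_Real"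
begin

section \<open>Powers with the convention that anything to the power zero is one\<close>

text \<open>The library has \<open>0 powr 0 = 0\<close>; here \<open>0\<^sup>0 = 1\<close> is needed.\<close>

definition rpow :: "real \<Rightarrow> real \<Rightarrow> real" where
  "rpow x \<kappa> = (if \<kappa> = 0 then 1 else x powr \<kappa>)"

text \<open>Only meant for exponents \<open>\<kappa> \<ge> 0\<close>.\<close>

definition epow :: "ennreal \<Rightarrow> real \<Rightarrow> ennreal" where
  "epow x \<kappa> = (if \<kappa> = 0 then 1 else if x = \<infinity> then \<infinity> else ennreal (enn2real x powr \<kappa>))"

section \<open>Continuous functions between Euclidean spaces of varying dimension\<close>

text \<open>
  \<open>\<real>\<^sup>d\<close> is \<open>carrier_vec d :: real vec set\<close>. A function between Euclidean spaces is a partial map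
  on \<open>real vec\<close>, so that, as in set theory, a function determines its domain \<open>\<real>\<^sup>m\<close>. As these
  carriers are pairwise disjoint, membership in \<open>C_space m n\<close> determines both \<open>m\<close> and \<open>n\<close>.
\<close>

definition eucl_norm :: "real vec \<Rightarrow> real" where
  "eucl_norm x = sqrt (x \<bullet> x)"

definition C_space :: "nat \<Rightarrow> nat \<Rightarrow> (real vec \<rightharpoonup> real vec) set" where
  "C_space m n = {f. dom f = carrier_vec m \<and> ran f \<subseteq> carrier_vec n \<and>
     (\<forall>x\<in>carrier_vec m. \<forall>e>0. \<exists>\<delta>>0. \<forall>y\<in>carrier_vec m.
        eucl_norm (y - x) < \<delta> \<longrightarrow> eucl_norm (the (f y) - the (f x)) < e)}"

text \<open>
  Families indexed by a set \<open>I\<close> are total HOL functions whose values outside \<open>I\<close> are irrelevant.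
\<close>

definition function_family :: "'i set \<Rightarrow> ('i \<Rightarrow> real vec \<rightharpoonup> real vec) \<Rightarrow> bool" where
  "function_family I f \<longleftrightarrow> (\<forall>i\<in>I. f i \<in> (\<Union>k\<in>{1..}. \<Union>l\<in>{1..}. C_space k l))"

text \<open>\<open>compose_upto g n = g n \<circ> \<dots> \<circ> g 1\<close> for \<open>n \<ge> 1\<close>, as partial maps.\<close>

primrec compose_upto :: "(nat \<Rightarrow> 'a \<rightharpoonup> 'a) \<Rightarrow> nat \<Rightarrow> 'a \<rightharpoonup> 'a" where
  "compose_upto g 0 = Some"
| "compose_upto g (Suc k) = g (Suc k) \<circ>\<^sub>m compose_upto g k"

section \<open>Artificial neural networks\<close>

type_synonym ann = "(real mat \<times> real vec) list"

text \<open>The list \<open>ls = [l\<^sub>0, \<dots>, l\<^sub>L]\<close> of layer dimensions has length \<open>L + 1\<close>; lists count from 0.\<close>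

definition ANN_with_dims :: "nat list \<Rightarrow> ann set" where
  "ANN_with_dims ls = {\<Phi>. length ls = length \<Phi> + 1 \<and>
     (\<forall>k<length \<Phi>. fst (\<Phi> ! k) \<in> carrier_mat (ls ! (k + 1)) (ls ! k) \<and>
                     snd (\<Phi> ! k) \<in> carrier_vec (ls ! (k + 1)))}"

definition ANN :: "ann set" where
  "ANN = (\<Union>ls\<in>{ls. length ls \<ge> 2 \<and> (\<forall>l\<in>set ls. l \<ge> 1)}. ANN_with_dims ls)"

definition num_params :: "ann \<Rightarrow> nat" where
  "num_params \<Phi> = (\<Sum>(W, B)\<leftarrow>\<Phi>. dim_row W * (dim_col W + 1))"

text \<open>The activation is applied after every layer except the last one.\<close>

fun ann_eval :: "(real \<Rightarrow> real) \<Rightarrow> ann \<Rightarrow> real vec \<Rightarrow> real vec" where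
  "ann_eval a [] x = x"
| "ann_eval a [(W, B)] x = W *\<^sub>v x + B"
| "ann_eval a ((W, B) # \<Psi> # \<Phi>) x = ann_eval a (\<Psi> # \<Phi>) (map_vec a (W *\<^sub>v x + B))"

definition realization :: "(real \<Rightarrow> real) \<Rightarrow> ann \<Rightarrow> real vec \<rightharpoonup> real vec" where
  "realization a \<Phi> = (\<lambda>x. Some (ann_eval a \<Phi> x)) |` carrier_vec (dim_col (fst (hd \<Phi>)))"

section \<open>Dimension mappings\<close>

text \<open>
  An \<open>N\<close>-tuple is a list of length \<open>N\<close>; the entry with index \<open>l \<in> {1, \<dots>, N}\<close> is at
  list position \<open>l - 1\<close>.
\<close>

definition dim_mapping :: "nat \<Rightarrow> 'i set \<Rightarrow> ('i \<Rightarrow> nat list) \<Rightarrow> bool" where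
  "dim_mapping N I d \<longleftrightarrow> (\<forall>i\<in>I. length (d i) = N \<and> (\<forall>k\<in>set (d i). k \<ge> 1))"

definition dim_tensor :: "('i \<Rightarrow> nat list) \<Rightarrow> ('j \<Rightarrow> nat list) \<Rightarrow> 'i \<times> 'j \<Rightarrow> nat list" where
  "dim_tensor d e = (\<lambda>(i, j). d i @ e j)"

text \<open>The identity on the positive integers as a 1-fold dimension mapping.\<close>

definition dim_id :: "nat \<Rightarrow> nat list" where
  "dim_id k = [k]"

definition dim_prod :: "nat list \<Rightarrow> real list \<Rightarrow> real" where
  "dim_prod ds rs = (\<Prod>l<length rs. real (ds ! l) powr (rs ! l))"

section \<open>Approximation spaces\<close>

text \<open>
  \<open>approx_space a w G H r\<^sub>0 [r\<^sub>1, \<dots>, r\<^sub>N] I d\<close>. In \<open>ennreal\<close> the growth condition is vacuous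
  when \<open>G = H = \<infinity>\<close>.
\<close>

definition approx_space ::
  "(real \<Rightarrow> real) \<Rightarrow> (real \<Rightarrow> real) \<Rightarrow> ('i \<Rightarrow> real \<Rightarrow> ennreal) \<Rightarrow> ('i \<Rightarrow> real \<Rightarrow> ennreal) \<Rightarrow>
   real \<Rightarrow> real list \<Rightarrow> 'i set \<Rightarrow> ('i \<Rightarrow> nat list) \<Rightarrow> ('i \<Rightarrow> real vec \<rightharpoonup> real vec) set" where
  "approx_space a w G H r0 rs I d = {f. function_family I f \<and>
     (\<exists>K::real. \<forall>i\<in>I. \<forall>\<epsilon>\<in>{0<..1}. \<exists>\<Phi>\<in>ANN. \<exists>m\<ge>1. \<exists>n\<ge>1. \<forall>x\<in>carrier_vec m.
        {f i, realization a \<Phi>} \<subseteq> C_space m n \<and>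
        real (num_params \<Phi>) \<le> K * \<epsilon> powr (- r0) * dim_prod (d i) rs \<and>
        w (eucl_norm x) * eucl_norm (the (f i x) - the (realization a \<Phi> x)) \<le> \<epsilon> \<and>
        ennreal (eucl_norm (the (realization a \<Phi> x))) \<le> G i \<epsilon> * (H i \<epsilon> + ennreal (eucl_norm x)))}"

end

theory Submission
  imports Defs "HOL-Analysis.L2_Norm"
begin

text \<open>
  All layers are approximated with one accuracy \<open>\<delta>\<close>, and the networks are composed by merging the
  last affine map of each with the first affine map of the next, so that \<open>n\<close> networks with at most
  \<open>p\<close> parameters yield one with \<open>O(n p\<^sup>2)\<close> parameters. Telescoping the composition, the error made
  in layer \<open>k\<close> is amplified by the Lipschitz constants of the later layers and by the growth of the
  earlier networks; by assumption this costs a factor \<open>\<delta> powr (- \<rho>)\<close> per layer, up to powers of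
  the dimensions. The total error is thus at most \<open>Q * \<delta> powr (1 - \<rho>)\<close> with \<open>Q\<close> polynomial in the
  dimensions, and \<open>\<delta>\<close> is chosen to make this equal to \<open>\<epsilon>\<close>.
\<close>

section \<open>The Euclidean norm and continuous maps\<close>

lemma eucl_norm_L2: "eucl_norm x = L2_set (\<lambda>i. x $ i) {0..<dim_vec x}"
  by (simp add: eucl_norm_def L2_set_def scalar_prod_def power2_eq_square)

lemma eucl_norm_nonneg [simp]: "eucl_norm x \<ge> 0"
  by (simp add: eucl_norm_L2 L2_set_nonneg)

lemma eucl_norm_triangle:
  assumes "x \<in> carrier_vec n" "y \<in> carrier_vec n" "z \<in> carrier_vec n"
  shows "eucl_norm (x - z) \<le> eucl_norm (x - y) + eucl_norm (y - z)"
proof -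
  have "eucl_norm (x - z) = L2_set (\<lambda>i. (x - y) $ i + (y - z) $ i) {0..<n}"
    unfolding eucl_norm_L2 using assms by (intro L2_set_cong) auto
  also have "\<dots> \<le> L2_set (\<lambda>i. (x - y) $ i) {0..<n} + L2_set (\<lambda>i. (y - z) $ i) {0..<n}"
    by (rule L2_set_triangle_ineq)
  finally show ?thesis
    using assms by (simp add: eucl_norm_L2)
qed

lemma C_spaceD:
  assumes "f \<in> C_space m n" "x \<in> carrier_vec m"
  shows "f x = Some (the (f x))" "the (f x) \<in> carrier_vec n"
proof -
  have "x \<in> dom f" "ran f \<subseteq> carrier_vec n"
    using assms by (auto simp: C_space_def)
  then show "f x = Some (the (f x))" "the (f x) \<in> carrier_vec n"
    by (auto simp: ran_def)
qed

text \<open>The zero vector of the domain reveals \<open>m\<close>, and its image reveals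
  \<open>n\<close>. This identifies the dimensions that an approximation space provides only
  existentially with the prescribed input and output dimensions.\<close>

lemma C_space_unique:
  assumes "f \<in> C_space m n" "f \<in> C_space m' n'"
  shows "m = m'" "n = n'"
proof -
  have "carrier_vec m = (carrier_vec m' :: real vec set)"
    using assms by (simp add: C_space_def)
  then have *: "(0\<^sub>v m :: real vec) \<in> carrier_vec m'"
    using zero_carrier_vec by blast
  then show "m = m'"
    using carrier_vecD[OF *] by simp
  show "n = n'"
    using C_spaceD(2)[OF assms(1) zero_carrier_vec] C_spaceD(2)[OF assms(2) *]
      carrier_vecD by fastforce
qed

lemma C_space_comp:
  assumes f: "f \<in> C_space m n" and g: "g \<in> C_space n p"
  shows "g \<circ>\<^sub>m f \<in> C_space m p"
proof -
  have dom: "dom f = carrier_vec m" "dom g = carrier_vec n"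
    and ran: "ran f \<subseteq> carrier_vec n" "ran g \<subseteq> carrier_vec p"
    using f g by (auto simp: C_space_def)
  have eq: "(g \<circ>\<^sub>m f) x = g (the (f x))" if "x \<in> carrier_vec m" for x
    using C_spaceD(1)[OF f that] by (metis map_comp_simps(2))
  have "dom (g \<circ>\<^sub>m f) = carrier_vec m"
  proof
    show "dom (g \<circ>\<^sub>m f) \<subseteq> carrier_vec m"
      using dom by (auto simp: map_comp_def split: option.splits)
    show "carrier_vec m \<subseteq> dom (g \<circ>\<^sub>m f)"
      using eq C_spaceD(2)[OF f] C_spaceD(1)[OF g] by (metis domI subsetI)
  qed
  moreover have "ran (g \<circ>\<^sub>m f) \<subseteq> carrier_vec p"
    using ran by (auto simp: map_comp_def ran_def split: option.splits)
  moreover have "\<exists>\<delta>>0. \<forall>y\<in>carrier_vec m. eucl_norm (y - x) < \<delta> \<longrightarrow>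
      eucl_norm (the ((g \<circ>\<^sub>m f) y) - the ((g \<circ>\<^sub>m f) x)) < e"
    if x: "x \<in> carrier_vec m" and e: "e > 0" for x e
  proof -
    obtain \<eta> where \<eta>: "\<eta> > 0" "\<And>z. z \<in> carrier_vec n \<Longrightarrow> eucl_norm (z - the (f x)) < \<eta> \<Longrightarrow>
        eucl_norm (the (g z) - the (g (the (f x)))) < e"
      using g C_spaceD(2)[OF f x] e unfolding C_space_def by blast
    obtain \<delta> where \<delta>: "\<delta> > 0" "\<And>y. y \<in> carrier_vec m \<Longrightarrow> eucl_norm (y - x) < \<delta> \<Longrightarrow>
        eucl_norm (the (f y) - the (f x)) < \<eta>"
      using f x \<eta>(1) unfolding C_space_def by blast
    show ?thesis
      using \<delta> \<eta>(2) C_spaceD(2)[OF f] eq x by (intro exI[of _ \<delta>]) auto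
  qed
  ultimately show ?thesis
    unfolding C_space_def by blast
qed

section \<open>Iterated composition along a chain of dimensions\<close>

text \<open>Throughout, \<open>D k\<close> is the dimension reached after \<open>k\<close> layers.
  The induction starts at 1 because \<open>compose_upto g 0\<close> is \<open>Some\<close>, which is
  defined on vectors of every dimension and so lies in no \<open>C_space\<close>.\<close>

lemma compose_upto_C_space:
  assumes "\<And>k. k \<in> {1..n} \<Longrightarrow> g k \<in> C_space (D (k - 1)) (D k)" "n \<ge> 1"
  shows "compose_upto g n \<in> C_space (D 0) (D n)"
  using assms(2,1)
proof (induction n rule: dec_induct)
  case base
  then show ?case
    using base[of 1] by (simp add: map_comp_def)
next
  case (step n)
  then show ?case
    using step.prems[of "Suc n"] by (auto intro!: C_space_comp)
qed

text \<open>These pointwise facts cover \<open>k = 0\<close> as well, which is where the inductions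
  on error and growth begin.\<close>

lemma compose_upto_Some:
  assumes g: "\<And>k. k \<in> {1..n} \<Longrightarrow> g k \<in> C_space (D (k - 1)) (D k)"
    and "x \<in> carrier_vec (D 0)" "k \<le> n"
  shows "compose_upto g k x = Some (the (compose_upto g k x))"
    "the (compose_upto g k x) \<in> carrier_vec (D k)"
proof -
  have "compose_upto g k x = Some (the (compose_upto g k x)) \<and>
      the (compose_upto g k x) \<in> carrier_vec (D k)"
  proof (cases k)
    case 0
    then show ?thesis using assms by simp
  next
    case (Suc k')
    then have "compose_upto g k \<in> C_space (D 0) (D k)"
      using assms by (intro compose_upto_C_space) auto
    then show ?thesis
      using C_spaceD assms(2) by metis
  qed
  then show "compose_upto g k x = Some (the (compose_upto g k x))"
    "the (compose_upto g k x) \<in> carrier_vec (D k)" by auto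
qed

lemma the_compose_upto_Suc:
  assumes "\<And>k. k \<in> {1..n} \<Longrightarrow> g k \<in> C_space (D (k - 1)) (D k)"
    and "x \<in> carrier_vec (D 0)" "Suc k \<le> n"
  shows "the (compose_upto g (Suc k) x) = the (g (Suc k) (the (compose_upto g k x)))"
proof -
  have "compose_upto g k x = Some (the (compose_upto g k x))"
    using assms by (intro compose_upto_Some(1)[of n]) auto
  then show ?thesis
    by (metis compose_upto.simps(2) map_comp_simps(2))
qed

section \<open>Composition of networks\<close>

text \<open>A recursive form of \<open>ANN_with_dims\<close> that hides the inner widths, so that
  proofs can follow the list of layers. Positivity is built in for the layer outputs only; for the
  input dimension it is a separate condition in \<open>ANN_iff\<close>.\<close>

fun ann_typed :: "nat \<Rightarrow> ann \<Rightarrow> nat \<Rightarrow> bool" where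
  "ann_typed m [] n \<longleftrightarrow> m = n"
| "ann_typed m ((W, B) # \<Phi>) n \<longleftrightarrow>
    (\<exists>l\<ge>1. W \<in> carrier_mat l m \<and> B \<in> carrier_vec l \<and> ann_typed l \<Phi> n)"

lemma ann_typed_if_dims:
  assumes "\<Phi> \<in> ANN_with_dims ls" "\<forall>l\<in>set ls. l \<ge> 1"
  shows "ann_typed (hd ls) \<Phi> (last ls)"
  using assms
proof (induction \<Phi> arbitrary: ls)
  case Nil
  then obtain l where "ls = [l]"
    by (auto simp: ANN_with_dims_def length_Suc_conv)
  then show ?case by simp
next
  case (Cons p \<Phi>)
  obtain W B where p: "p = (W, B)" by force
  obtain l l' ls' where ls: "ls = l # l' # ls'"
    using Cons.prems by (auto simp: ANN_with_dims_def length_Suc_conv)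
  have "\<Phi> \<in> ANN_with_dims (l' # ls')"
    using Cons.prems unfolding ANN_with_dims_def ls by (auto; fastforce)
  then have "ann_typed l' \<Phi> (last ls)"
    using Cons.IH[of "l' # ls'"] Cons.prems by (simp add: ls)
  moreover have "W \<in> carrier_mat l' l" "B \<in> carrier_vec l'"
    using Cons.prems unfolding ANN_with_dims_def ls p by fastforce+
  ultimately show ?case
    using Cons.prems unfolding ls p by auto
qed

lemma dims_if_ann_typed:
  assumes "ann_typed m \<Phi> n" "m \<ge> 1"
  shows "\<exists>ls. \<Phi> \<in> ANN_with_dims ls \<and> hd ls = m \<and> (\<forall>l\<in>set ls. l \<ge> 1)"
  using assms
proof (induction m \<Phi> n rule: ann_typed.induct)
  case (1 m n)
  then show ?case
    by (intro exI[of _ "[m]"]) (auto simp: ANN_with_dims_def)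
next
  case (2 m W B \<Phi> n)
  then obtain l where l: "l \<ge> 1" "W \<in> carrier_mat l m" "B \<in> carrier_vec l" "ann_typed l \<Phi> n"
    by auto
  with 2 obtain ls where ls: "\<Phi> \<in> ANN_with_dims ls" "hd ls = l" "\<forall>l\<in>set ls. l \<ge> 1"
    by blast
  then have "ls \<noteq> []"
    by (auto simp: ANN_with_dims_def)
  with ls(2) have "ls ! 0 = l"
    by (simp add: hd_conv_nth)
  then have "(W, B) # \<Phi> \<in> ANN_with_dims (m # ls)"
    using ls l by (auto simp: ANN_with_dims_def nth_Cons split: nat.splits)
  then show ?case
    using ls(3) 2(3) by (intro exI[of _ "m # ls"]) auto
qed

lemma ANN_iff: "\<Phi> \<in> ANN \<longleftrightarrow> \<Phi> \<noteq> [] \<and> (\<exists>m\<ge>1. \<exists>n. ann_typed m \<Phi> n)"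
proof
  assume "\<Phi> \<in> ANN"
  then obtain ls where ls: "\<Phi> \<in> ANN_with_dims ls" "length ls \<ge> 2" "\<forall>l\<in>set ls. l \<ge> 1"
    by (auto simp: ANN_def)
  then have "hd ls \<in> set ls"
    by (intro hd_in_set) auto
  with ls have "ann_typed (hd ls) \<Phi> (last ls)" "hd ls \<ge> 1"
    by (auto simp: ann_typed_if_dims)
  moreover have "\<Phi> \<noteq> []"
    using ls by (auto simp: ANN_with_dims_def)
  ultimately show "\<Phi> \<noteq> [] \<and> (\<exists>m\<ge>1. \<exists>n. ann_typed m \<Phi> n)"
    by blast
next
  assume *: "\<Phi> \<noteq> [] \<and> (\<exists>m\<ge>1. \<exists>n. ann_typed m \<Phi> n)"
  then obtain ls where "\<Phi> \<in> ANN_with_dims ls" "\<forall>l\<in>set ls. l \<ge> 1"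
    using dims_if_ann_typed by blast
  moreover from this * have "length ls \<ge> 2"
    by (cases \<Phi>) (auto simp: ANN_with_dims_def)
  ultimately show "\<Phi> \<in> ANN"
    unfolding ANN_def by blast
qed

lemma ann_typed_hd: "ann_typed m \<Phi> n \<Longrightarrow> \<Phi> \<noteq> [] \<Longrightarrow> dim_col (fst (hd \<Phi>)) = m"
  by (induction m \<Phi> n rule: ann_typed.induct) auto

lemma ann_eval_carrier:
  assumes "ann_typed m \<Phi> n" "x \<in> carrier_vec m"
  shows "ann_eval a \<Phi> x \<in> carrier_vec n"
  using assms
proof (induction a \<Phi> x arbitrary: m rule: ann_eval.induct)
  case (3 a W B \<Psi> \<Phi> x)
  obtain W' B' where \<Psi>: "\<Psi> = (W', B')" by force
  obtain l where "W \<in> carrier_mat l m" "B \<in> carrier_vec l" "ann_typed l (\<Psi> # \<Phi>) n"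
    using 3 by auto
  then show ?case
    using 3 by simp
qed auto

section \<open>Merging two networks at their interface\<close>

text \<open>The first argument is the outer network. No activation follows the last layer of the
  inner one, so W(Vx + b) + B = (WV)x + (Wb + B) fuses the two affine maps at the interface into one
  layer. This works for every activation, whereas an interposed identity network would need an
  activation able to represent the identity. The last equation is a default reached only if one of
  the networks is empty.\<close>

fun ann_comp :: "ann \<Rightarrow> ann \<Rightarrow> ann" where
  "ann_comp ((W, B) # \<Phi>) [(V, b)] = (W * V, W *\<^sub>v b + B) # \<Phi>"
| "ann_comp \<Phi> (p # q # \<Psi>) = p # ann_comp \<Phi> (q # \<Psi>)"
| "ann_comp \<Phi> _ = \<Phi>"

lemma ann_comp_nonempty: "\<Phi> \<noteq> [] \<Longrightarrow> ann_comp \<Phi> \<Psi> \<noteq> []"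
  by (induction \<Phi> \<Psi> rule: ann_comp.induct) auto

lemma ann_typed_comp:
  assumes "ann_typed n \<Phi> p" "ann_typed m \<Psi> n" "\<Phi> \<noteq> []" "\<Psi> \<noteq> []"
  shows "ann_typed m (ann_comp \<Phi> \<Psi>) p"
  using assms
proof (induction \<Phi> \<Psi> arbitrary: m rule: ann_comp.induct)
  case (1 W B \<Phi> V b)
  then obtain l where "l \<ge> 1" "W \<in> carrier_mat l n" "B \<in> carrier_vec l" "ann_typed l \<Phi> p"
    by auto
  moreover have "V \<in> carrier_mat n m" "b \<in> carrier_vec n"
    using 1 by auto
  ultimately show ?case
    by (auto intro!: exI[of _ l])
next
  case (2 \<Phi> q q' \<Psi>)
  then show ?case
    by (cases q; cases q') auto
qed auto

lemma ann_eval_comp: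
  assumes "ann_typed n \<Phi> p" "ann_typed m \<Psi> n" "\<Phi> \<noteq> []" "\<Psi> \<noteq> []" "x \<in> carrier_vec m"
  shows "ann_eval a (ann_comp \<Phi> \<Psi>) x = ann_eval a \<Phi> (ann_eval a \<Psi> x)"
  using assms
proof (induction \<Phi> \<Psi> arbitrary: m x rule: ann_comp.induct)
  case (1 W B \<Phi> V b)
  then obtain l where W: "W \<in> carrier_mat l n" "B \<in> carrier_vec l"
    by auto
  have V: "V \<in> carrier_mat n m" "b \<in> carrier_vec n"
    using 1 by auto
  have "W * V *\<^sub>v x + (W *\<^sub>v b + B) = (W *\<^sub>v (V *\<^sub>v x) + W *\<^sub>v b) + B"
    using W V 1(5) by (auto simp: assoc_mult_mat_vec[of _ l n _ m] intro!: assoc_add_vec[symmetric])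
  also have "\<dots> = W *\<^sub>v (V *\<^sub>v x + b) + B"
    using W V 1(5) by (auto simp: mult_add_distrib_mat_vec[of _ l n])
  finally have *: "W * V *\<^sub>v x + (W *\<^sub>v b + B) = W *\<^sub>v (V *\<^sub>v x + b) + B" .
  \<comment> \<open>The fused layer is followed by the activation exactly if the outer network has
    further layers, hence the case distinction.\<close>
  show ?case
    by (cases \<Phi>) (simp_all add: *)
next
  case (2 \<Phi> q q' \<Psi>)
  obtain V b where q: "q = (V, b)" by force
  obtain V' b' where q': "q' = (V', b')" by force
  obtain l where l: "V \<in> carrier_mat l m" "b \<in> carrier_vec l" "ann_typed l (q' # \<Psi>) n"
    using 2(3) by (auto simp: q)
  \<comment> \<open>Non-emptiness makes \<open>q\<close> a hidden layer of the merged network too,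
    so that the activation is applied after it on both sides.\<close>
  have "ann_comp \<Phi> (q' # \<Psi>) \<noteq> []"
    using 2 ann_comp_nonempty by blast
  then obtain u us where u: "ann_comp \<Phi> (q' # \<Psi>) = u # us"
    by (cases "ann_comp \<Phi> (q' # \<Psi>)") auto
  have "map_vec a (V *\<^sub>v x + b) \<in> carrier_vec l"
    using carrier_vecD[OF l(2)] by (intro carrier_vecI) simp
  then show ?case
    using 2(1)[OF 2(2) l(3) 2(4)] u by (simp add: q)
qed auto

lemma realization_comp:
  assumes "ann_typed n \<Phi> p" "ann_typed m \<Psi> n" "\<Phi> \<noteq> []" "\<Psi> \<noteq> []"
  shows "realization a (ann_comp \<Phi> \<Psi>) = realization a \<Phi> \<circ>\<^sub>m realization a \<Psi>"
proof
  fix x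
  have "dim_col (fst (hd (ann_comp \<Phi> \<Psi>))) = m"
    by (rule ann_typed_hd[OF ann_typed_comp[OF assms] ann_comp_nonempty]) fact
  then show "realization a (ann_comp \<Phi> \<Psi>) x = (realization a \<Phi> \<circ>\<^sub>m realization a \<Psi>) x"
    using ann_eval_comp[OF assms] ann_eval_carrier[OF assms(2)] ann_typed_hd[OF assms(1,3)]
      ann_typed_hd[OF assms(2,4)]
    by (auto simp: realization_def map_comp_def restrict_map_def)
qed

text \<open>The layer dimensions are recovered from the function alone: its domain gives the input
  dimension, its value at zero the output dimension.\<close>

lemma ann_typed_if_realization:
  assumes "\<Phi> \<in> ANN" "realization a \<Phi> \<in> C_space m n"
  shows "ann_typed m \<Phi> n"
proof -
  obtain m' n' where \<Phi>: "\<Phi> \<noteq> []" "ann_typed m' \<Phi> n'"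
    using assms(1) by (auto simp: ANN_iff)
  have dom: "dom (realization a \<Phi>) = carrier_vec m'"
    using ann_typed_hd[OF \<Phi>(2,1)] by (simp add: realization_def)
  moreover have "dom (realization a \<Phi>) = carrier_vec m"
    using assms(2) by (simp add: C_space_def)
  ultimately have "(0\<^sub>v m' :: real vec) \<in> carrier_vec m"
    using zero_carrier_vec by blast
  then have m: "m' = m"
    using carrier_vecD by fastforce
  have "the (realization a \<Phi> (0\<^sub>v m)) = ann_eval a \<Phi> (0\<^sub>v m)"
    using ann_typed_hd[OF \<Phi>(2,1)] m by (simp add: realization_def)
  then have "n' = n"
    using C_spaceD(2)[OF assms(2), of "0\<^sub>v m"] ann_eval_carrier[OF \<Phi>(2), of "0\<^sub>v m" a] m
      carrier_vecD by fastforce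
  with m \<Phi> show ?thesis by simp
qed

section \<open>Counting parameters and controlling the last width\<close>

lemma num_params_Cons: "num_params ((W, B) # \<Phi>) = dim_row W * (dim_col W + 1) + num_params \<Phi>"
  by (simp add: num_params_def)

text \<open>The last layer has at least one row, and each row contributes its columns and one bias
  entry.\<close>

lemma last_dim_le_num_params:
  assumes "ann_typed m \<Phi> n" "\<Phi> \<noteq> []"
  shows "dim_col (fst (last \<Phi>)) + 1 \<le> num_params \<Phi>"
  using assms
proof (induction m \<Phi> n rule: ann_typed.induct)
  case (2 m W B \<Phi> n)
  then obtain l where l: "l \<ge> 1" "W \<in> carrier_mat l m" "ann_typed l \<Phi> n"
    by auto
  show ?case
  proof (cases "\<Phi> = []")
    case True
    have "1 * (m + 1) \<le> l * (m + 1)"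
      using l by (intro mult_right_mono) auto
    then show ?thesis
      using True l(2) by (simp add: num_params_Cons)
  next
    case False
    then show ?thesis
      using 2(1)[OF l(3)] by (simp add: num_params_Cons)
  qed
qed simp

text \<open>Merging changes one layer: the fused matrix has the rows of the first layer of
  \<open>\<Phi>\<close> and the columns of the last layer of \<open>\<Psi>\<close>. Its entries and
  biases cost at most \<open>num_params \<Phi>\<close> times (columns + 1), and the remaining layers
  of \<open>\<Phi>\<close> cost at most \<open>num_params \<Phi>\<close> once more, whence the
  2.\<close>

lemma num_params_comp:
  assumes "\<Phi> \<noteq> []" "\<Psi> \<noteq> []"
  shows "num_params (ann_comp \<Phi> \<Psi>) \<le>
    num_params \<Psi> + num_params \<Phi> * (dim_col (fst (last \<Psi>)) + 2)"
  using assms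
proof (induction \<Phi> \<Psi> rule: ann_comp.induct)
  case (1 W B \<Phi> V b)
  have "dim_row W * (dim_col V + 1) \<le> dim_row W * (dim_col W + 1) * (dim_col V + 2)"
    by (simp add: algebra_simps)
  then show ?case
    by (simp add: num_params_Cons algebra_simps)
next
  case (2 \<Phi> q q' \<Psi>)
  then show ?case
    by (cases q) (simp add: num_params_Cons)
qed auto

text \<open>If \<open>\<Phi>\<close> is a single layer, the fused layer is the last one and takes
  its columns from \<open>\<Psi>\<close>; otherwise the last layer of \<open>\<Phi>\<close>
  survives. Repeated merging therefore never creates a new last width.\<close>

lemma last_dim_comp:
  assumes "\<Phi> \<noteq> []" "\<Psi> \<noteq> []"
  shows "dim_col (fst (last (ann_comp \<Phi> \<Psi>))) \<in>
    {dim_col (fst (last \<Phi>)), dim_col (fst (last \<Psi>))}"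
  using assms
proof (induction \<Phi> \<Psi> rule: ann_comp.induct)
  case (2 \<Phi> q q' \<Psi>)
  then show ?case
    using ann_comp_nonempty[of \<Phi> "q' # \<Psi>"] by auto
qed auto

text \<open>Only the last hidden width of the network built so far enters the next merged layer; it
  stays below \<open>p\<close>, which makes the number of parameters linear in \<open>n\<close>.\<close>

lemma compose_upto_realization:
  fixes p :: real
  assumes "\<And>k. k \<in> {1..n} \<Longrightarrow> \<Phi> k \<in> ANN"
    and "\<And>k. k \<in> {1..n} \<Longrightarrow> realization a (\<Phi> k) \<in> C_space (D (k - 1)) (D k)"
    and "\<And>k. k \<in> {1..n} \<Longrightarrow> num_params (\<Phi> k) \<le> p"
    and "n \<ge> 1"
  shows "\<exists>\<Psi>. \<Psi> \<noteq> [] \<and> ann_typed (D 0) \<Psi> (D n) \<and>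
    realization a \<Psi> = compose_upto (\<lambda>k. realization a (\<Phi> k)) n \<and>
    dim_col (fst (last \<Psi>)) + 1 \<le> p \<and> num_params \<Psi> \<le> 2 * real n * p\<^sup>2"
  using assms(4,1-3)
proof (induction n rule: dec_induct)
  case base
  have typed: "ann_typed (D 0) (\<Phi> 1) (D 1)" and ne: "\<Phi> 1 \<noteq> []"
    using ann_typed_if_realization[OF base(1,2), of 1] base(1)[of 1] by (auto simp: ANN_iff)
  from last_dim_le_num_params[OF this] base(3)[of 1]
  have last: "dim_col (fst (last (\<Phi> 1))) + 1 \<le> p"
    by simp
  then have "p \<ge> 1" by simp
  then have "p \<le> p\<^sup>2"
    using self_le_power[of p 2] by simp
  then have "num_params (\<Phi> 1) \<le> 2 * 1 * p\<^sup>2"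
    using base(3)[of 1] \<open>p \<ge> 1\<close> by simp
  then show ?case
    using typed ne last by (intro exI[of _ "\<Phi> 1"]) (simp add: map_comp_def)
next
  case (step n)
  then obtain \<Psi> where \<Psi>: "\<Psi> \<noteq> []" "ann_typed (D 0) \<Psi> (D n)"
    "realization a \<Psi> = compose_upto (\<lambda>k. realization a (\<Phi> k)) n"
    "dim_col (fst (last \<Psi>)) + 1 \<le> p" "num_params \<Psi> \<le> 2 * real n * p\<^sup>2"
    by (auto simp del: of_nat_Suc)
  let ?\<Phi> = "\<Phi> (Suc n)"
  have typed: "ann_typed (D n) ?\<Phi> (D (Suc n))" and ne: "?\<Phi> \<noteq> []"
    using ann_typed_if_realization[OF step.prems(1,2), of "Suc n"] step.prems(1)[of "Suc n"]
    by (auto simp: ANN_iff)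
  have "dim_col (fst (last ?\<Phi>)) + 1 \<le> p"
    using last_dim_le_num_params[OF typed ne] step.prems(3)[of "Suc n"] by simp
  then have last: "dim_col (fst (last (ann_comp ?\<Phi> \<Psi>))) + 1 \<le> p"
    using last_dim_comp[OF ne \<Psi>(1)] \<Psi>(4) by auto
  then have "p \<ge> 1" by simp
  have "real (num_params (ann_comp ?\<Phi> \<Psi>)) \<le>
      real (num_params \<Psi>) + real (num_params ?\<Phi>) * real (dim_col (fst (last \<Psi>)) + 2)"
    using of_nat_mono[OF num_params_comp[OF ne \<Psi>(1)], where ?'a = real]
    by (simp only: of_nat_add of_nat_mult)
  \<comment> \<open>The invariant (last width) + 1 <= p together with p >= 1 gives (last width) + 2
    <= 2p, so each merge adds at most twice the square of p.\<close>
  also have "\<dots> \<le> 2 * real n * p\<^sup>2 + p * (2 * p)"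
  proof (rule add_mono[OF \<Psi>(5) mult_mono])
    show "real (num_params ?\<Phi>) \<le> p"
      using step.prems(3)[of "Suc n"] by simp
    show "real (dim_col (fst (last \<Psi>)) + 2) \<le> 2 * p"
      using \<Psi>(4) \<open>p \<ge> 1\<close> by simp
  qed (use \<open>p \<ge> 1\<close> in auto)
  also have "\<dots> = 2 * real (Suc n) * p\<^sup>2"
    by (simp add: algebra_simps power2_eq_square)
  finally have "num_params (ann_comp ?\<Phi> \<Psi>) \<le> 2 * real (Suc n) * p\<^sup>2" .
  then show ?case
    using last ann_comp_nonempty[OF ne] ann_typed_comp[OF typed \<Psi>(2) ne \<Psi>(1)]
      realization_comp[OF typed \<Psi>(2) ne \<Psi>(1), of a] \<Psi>(3)
    by (intro exI[of _ "ann_comp ?\<Phi> \<Psi>"]) simp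
qed

section \<open>Error propagation\<close>

text \<open>The local errors are taken along the orbit of \<open>g\<close>, because growth bounds
  are available for the networks; the maps \<open>f\<close> only have to transport earlier errors,
  at the price of the later Lipschitz constants. Working in \<open>ennreal\<close> admits infinite
  constants.\<close>

lemma compose_upto_error:
  fixes L :: "nat \<Rightarrow> ennreal"
  assumes f: "\<And>k. k \<in> {1..n} \<Longrightarrow> f k \<in> C_space (D (k - 1)) (D k)"
    and g: "\<And>k. k \<in> {1..n} \<Longrightarrow> g k \<in> C_space (D (k - 1)) (D k)"
    and L: "\<And>k x y. k \<in> {1..n} \<Longrightarrow> x \<in> carrier_vec (D (k - 1)) \<Longrightarrow> y \<in> carrier_vec (D (k - 1)) \<Longrightarrow>
      ennreal (eucl_norm (the (f k x) - the (f k y))) \<le> L k * ennreal (eucl_norm (x - y))"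
    and x: "x \<in> carrier_vec (D 0)" and "k \<le> n"
  shows "ennreal (eucl_norm (the (compose_upto f k x) - the (compose_upto g k x))) \<le>
    (\<Sum>m\<in>{1..k}. (\<Prod>l\<in>{m+1..k}. L l) *
      ennreal (eucl_norm (the (f m (the (compose_upto g (m - 1) x))) -
        the (g m (the (compose_upto g (m - 1) x))))))"
  using \<open>k \<le> n\<close>
proof (induction k)
  case 0
  have "x - x = 0\<^sub>v (D 0)"
    using x by auto
  then show ?case
    by (simp add: eucl_norm_def)
next
  case (Suc k)
  let ?u = "the (compose_upto f k x)" and ?v = "the (compose_upto g k x)"
  let ?\<eta> = "\<lambda>m. ennreal (eucl_norm (the (f m (the (compose_upto g (m - 1) x))) -
        the (g m (the (compose_upto g (m - 1) x)))))"
  have carrier: "?u \<in> carrier_vec (D k)" "?v \<in> carrier_vec (D k)"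
    using compose_upto_Some(2)[of n f D x k] compose_upto_Some(2)[of n g D x k] f g x Suc.prems
    by auto
  have fk: "f (Suc k) \<in> C_space (D k) (D (Suc k))" and gk: "g (Suc k) \<in> C_space (D k) (D (Suc k))"
    using f[of "Suc k"] g[of "Suc k"] Suc.prems by auto
  have "ennreal (eucl_norm (the (compose_upto f (Suc k) x) - the (compose_upto g (Suc k) x))) =
      ennreal (eucl_norm (the (f (Suc k) ?u) - the (g (Suc k) ?v)))"
    using the_compose_upto_Suc[of n f D x k] the_compose_upto_Suc[of n g D x k] f g x Suc.prems
    by simp
  \<comment> \<open>The intermediate point applies the exact layer to the approximate input: one
    part is the transported old error, the other the fresh error of this layer.\<close>
  also have "\<dots> \<le> ennreal (eucl_norm (the (f (Suc k) ?u) - the (f (Suc k) ?v)) +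
      eucl_norm (the (f (Suc k) ?v) - the (g (Suc k) ?v)))"
    using C_spaceD(2)[OF fk] C_spaceD(2)[OF gk] carrier
    by (intro ennreal_leI eucl_norm_triangle)
  also have "\<dots> = ennreal (eucl_norm (the (f (Suc k) ?u) - the (f (Suc k) ?v))) + ?\<eta> (Suc k)"
    by simp
  also have "\<dots> \<le> L (Suc k) * ennreal (eucl_norm (?u - ?v)) + ?\<eta> (Suc k)"
    using L[of "Suc k" ?u ?v] Suc.prems carrier by (intro add_mono) auto
  also have "\<dots> \<le> L (Suc k) * (\<Sum>m\<in>{1..k}. (\<Prod>l\<in>{m+1..k}. L l) * ?\<eta> m) + ?\<eta> (Suc k)"
    using Suc by (intro add_mono mult_left_mono) auto
  also have "\<dots> = (\<Sum>m\<in>{1..k}. (\<Prod>l\<in>{m+1..Suc k}. L l) * ?\<eta> m) + ?\<eta> (Suc k)"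
    unfolding sum_distrib_left
    by (intro arg_cong2[of _ _ _ _ "(+)"] sum.cong refl)
       (simp add: prod.nat_ivl_Suc' mult_ac)
  also have "\<dots> = (\<Sum>m\<in>{1..Suc k}. (\<Prod>l\<in>{m+1..Suc k}. L l) * ?\<eta> m)"
    by simp
  finally show ?case .
qed

text \<open>With each \<open>G l\<close> raised to at least 1 the partial products are at least 1,
  so every offset \<open>H k\<close> can be enlarged to the full product times \<open>h\<close>; the
  offsets then simply add up to \<open>m\<close> copies of \<open>h\<close>.\<close>

lemma compose_upto_growth:
  fixes G H :: "nat \<Rightarrow> ennreal"
  assumes g: "\<And>k. k \<in> {1..n} \<Longrightarrow> g k \<in> C_space (D (k - 1)) (D k)"
    and gr: "\<And>k x. k \<in> {1..m} \<Longrightarrow> x \<in> carrier_vec (D (k - 1)) \<Longrightarrow>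
      ennreal (eucl_norm (the (g k x))) \<le> G k * (H k + ennreal (eucl_norm x))"
    and x: "x \<in> carrier_vec (D 0)" and "m \<le> n"
    and H: "\<And>k. k \<in> {1..m} \<Longrightarrow> H k \<le> h"
  shows "ennreal (eucl_norm (the (compose_upto g m x))) \<le>
    (\<Prod>l\<in>{1..m}. max (G l) 1) * (of_nat m * h + ennreal (eucl_norm x))"
  using gr H \<open>m \<le> n\<close>
proof (induction m)
  case (Suc m)
  let ?v = "the (compose_upto g m x)" and ?P = "\<Prod>l\<in>{1..m}. max (G l) 1"
  have v: "?v \<in> carrier_vec (D m)"
    using compose_upto_Some(2)[of n g D x m] g x Suc.prems by auto
  have "?P \<ge> 1"
    by (intro prod_ge_1) auto
  have "ennreal (eucl_norm (the (compose_upto g (Suc m) x))) = ennreal (eucl_norm (the (g (Suc m) ?v)))"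
    using the_compose_upto_Suc[of n g D x m] g x Suc.prems by simp
  also have "\<dots> \<le> G (Suc m) * (H (Suc m) + ennreal (eucl_norm ?v))"
    using Suc.prems(1)[of "Suc m" ?v] v by simp
  \<comment> \<open>Since \<open>?P\<close> is at least 1, the new offset is bounded by
    \<open>?P * h\<close>, after which \<open>?P\<close> factors out and the count of offsets rises
    by one.\<close>
  also have "\<dots> \<le> max (G (Suc m)) 1 * (?P * h + ?P * (of_nat m * h + ennreal (eucl_norm x)))"
  proof (intro mult_mono add_mono)
    have "H (Suc m) \<le> 1 * h"
      using Suc.prems by auto
    also have "\<dots> \<le> ?P * h"
      by (intro mult_right_mono \<open>?P \<ge> 1\<close>) auto
    finally show "H (Suc m) \<le> ?P * h" .
    show "ennreal (eucl_norm ?v) \<le> ?P * (of_nat m * h + ennreal (eucl_norm x))"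
      using Suc by auto
  qed auto
  also have "\<dots> = (\<Prod>l\<in>{1..Suc m}. max (G l) 1) * (of_nat (Suc m) * h + ennreal (eucl_norm x))"
    by (simp add: algebra_simps)
  finally show ?case .
qed simp

section \<open>Transfer of the polynomial weight through growth bounds\<close>

lemma rpow_nonneg [simp]: "rpow x \<kappa> \<ge> 0"
  by (simp add: rpow_def)

text \<open>Compares the weight at an intermediate point of norm \<open>v\<close> with the weight at
  the starting point of norm \<open>x\<close>. The constants come from n + x <= 2n max(1, x), from
  bounding the power of max(1, x) by 1 + \<open>x powr \<kappa>\<close>, and from a factor 2 that
  absorbs the leading 1.\<close>

lemma one_plus_rpow_le_epow:
  assumes v: "0 \<le> v" and x: "0 \<le> x" and T: "T \<ge> 1" and n: "n \<ge> (1::real)" and \<kappa>: "\<kappa> \<ge> 0"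
    and le: "ennreal v \<le> T * ennreal (n + x)"
  shows "ennreal (1 + rpow v \<kappa>) \<le> epow T \<kappa> * ennreal (2 * (2 * n) powr \<kappa> * (1 + rpow x \<kappa>))"
proof -
  have pos: "2 * (2 * n) powr \<kappa> * (1 + rpow x \<kappa>) > 0"
    using n by (intro mult_pos_pos add_pos_nonneg) auto
  \<comment> \<open>The case of exponent zero comes first: an infinite \<open>T\<close> makes the
    bound trivial only for a positive exponent, as \<open>epow\<close> sends infinity to 1 at
    exponent 0.\<close>
  consider "\<kappa> = 0" | "\<kappa> > 0" "T = \<infinity>" | t where "\<kappa> > 0" "T = ennreal t" "t \<ge> 0"
  proof (cases T)
    case (real t)
    then show thesis using \<kappa> that(1,3) by (cases "\<kappa> = 0") auto
  next
    case top
    then show thesis using \<kappa> that(1,2) by (cases "\<kappa> = 0") auto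
  qed
  then show ?thesis
  proof cases
    case 1
    then show ?thesis
      using n by (auto simp: rpow_def epow_def intro!: ennreal_leI)
  next
    case 2
    moreover define c where "c = 2 * (2 * n) powr \<kappa> * (1 + rpow x \<kappa>)"
    ultimately have "epow T \<kappa> * ennreal c = \<infinity>"
      using pos by (simp add: epow_def ennreal_top_mult flip: c_def)
    then show ?thesis
      by (simp flip: c_def)
  next
    case (3 t)
    have t: "t \<ge> 1"
      using T 3 by (simp flip: ennreal_1)
    have vt: "v \<le> t * (n + x)"
    proof -
      have "ennreal v \<le> ennreal (t * (n + x))"
        using le 3 n x by (simp only: ennreal_mult)
      then show ?thesis
        using 3 n x by (simp add: ennreal_le_iff)
    qed
    have "n + x \<le> 2 * n * max 1 x"
    proof (cases "x \<le> 1")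
      case False
      have "n + x \<le> n * x + n * x"
        using False n by (intro add_mono) auto
      then show ?thesis using False by simp
    qed (use n in auto)
    then have "v \<le> t * (2 * n * max 1 x)"
      using vt t by (meson mult_left_mono order_trans zero_le_one)
    then have "v powr \<kappa> \<le> (t * (2 * n * max 1 x)) powr \<kappa>"
      using v \<kappa> by (intro powr_mono2) auto
    also have "\<dots> = t powr \<kappa> * ((2 * n) powr \<kappa> * max 1 x powr \<kappa>)"
      using t n by (simp add: powr_mult)
    also have "max 1 x powr \<kappa> \<le> 1 + x powr \<kappa>"
      using x by (auto simp: max_def)
    finally have *: "v powr \<kappa> \<le> t powr \<kappa> * ((2 * n) powr \<kappa> * (1 + x powr \<kappa>))"
      by (simp add: mult_left_mono)
    \<comment> \<open>The bound for \<open>v powr \<kappa>\<close> is itself at least 1, so adding 1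
      at most doubles it.\<close>
    have "1 * (1 * 1) \<le> t powr \<kappa> * ((2 * n) powr \<kappa> * (1 + x powr \<kappa>))"
      using t n \<kappa> by (intro mult_mono ge_one_powr_ge_zero) auto
    with * have "1 + v powr \<kappa> \<le> t powr \<kappa> * (2 * (2 * n) powr \<kappa> * (1 + x powr \<kappa>))"
      by simp
    then have "ennreal (1 + v powr \<kappa>) \<le>
        ennreal (t powr \<kappa>) * ennreal (2 * (2 * n) powr \<kappa> * (1 + x powr \<kappa>))"
      by (subst ennreal_mult[symmetric]) (auto simp del: ennreal_plus intro!: ennreal_leI)
    then show ?thesis
      using 3 by (simp add: epow_def rpow_def del: ennreal_plus)
  qed
qed

text \<open>The constant \<open>c\<close> bounds the amplification of the error committed in layer \<open>k\<close> by the later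
  layers together with the growth of the earlier ones.\<close>

lemma compose_upto_weighted_error:
  fixes L G H :: "nat \<Rightarrow> ennreal"
  assumes f: "\<And>k. k \<in> {1..n} \<Longrightarrow> f k \<in> C_space (D (k - 1)) (D k)"
    and g: "\<And>k. k \<in> {1..n} \<Longrightarrow> g k \<in> C_space (D (k - 1)) (D k)"
    and L: "\<And>k x y. k \<in> {1..n} \<Longrightarrow> x \<in> carrier_vec (D (k - 1)) \<Longrightarrow> y \<in> carrier_vec (D (k - 1)) \<Longrightarrow>
      ennreal (eucl_norm (the (f k x) - the (f k y))) \<le> L k * ennreal (eucl_norm (x - y))"
    and gr: "\<And>k x. 1 \<le> k \<Longrightarrow> k < n \<Longrightarrow> x \<in> carrier_vec (D (k - 1)) \<Longrightarrow>
      ennreal (eucl_norm (the (g k x))) \<le> G k * (H k + ennreal (eucl_norm x))"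
    and err: "\<And>k x. k \<in> {1..n} \<Longrightarrow> x \<in> carrier_vec (D (k - 1)) \<Longrightarrow>
      eucl_norm (the (f k x) - the (g k x)) \<le> \<delta> * (1 + rpow (eucl_norm x) \<kappa>)"
    and c: "\<And>k. k \<in> {1..n} \<Longrightarrow> (\<Prod>l\<in>{k+1..n}. L l) *
      epow (Max ({H l |l. 0 < l \<and> l < k} \<union> {1}) * (\<Prod>l\<in>{1..k-1}. max (G l) 1)) \<kappa> \<le> ennreal c"
    and x: "x \<in> carrier_vec (D 0)"
    and "n \<ge> 1" "\<delta> \<ge> 0" "\<kappa> \<ge> 0" "c \<ge> 0"
  shows "eucl_norm (the (compose_upto f n x) - the (compose_upto g n x)) \<le>
    n * c * \<delta> * (2 * (2 * real n) powr \<kappa>) * (1 + rpow (eucl_norm x) \<kappa>)"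
proof -
  define b where "b = c * (\<delta> * (2 * (2 * real n) powr \<kappa> * (1 + rpow (eucl_norm x) \<kappa>)))"
  have "b \<ge> 0"
    unfolding b_def using \<open>\<delta> \<ge> 0\<close> \<open>c \<ge> 0\<close> by (intro mult_nonneg_nonneg add_nonneg_nonneg) auto
  let ?y = "\<lambda>m. the (compose_upto g m x)"
  have summand: "(\<Prod>l\<in>{k+1..n}. L l) *
      ennreal (eucl_norm (the (f k (?y (k - 1))) - the (g k (?y (k - 1))))) \<le> ennreal b"
    if k: "k \<in> {1..n}" for k
  proof -
    define h where "h = Max ({H l |l. 0 < l \<and> l < k} \<union> {1})"
    let ?P = "\<Prod>l\<in>{1..k-1}. max (G l) 1" and ?E = "2 * (2 * real n) powr \<kappa> * (1 + rpow (eucl_norm x) \<kappa>)"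
    have fin: "finite ({H l |l. 0 < l \<and> l < k} \<union> {1})"
      by simp
    have h: "h \<ge> 1" "\<And>l. l \<in> {1..k-1} \<Longrightarrow> H l \<le> h"
      unfolding h_def using fin by (auto intro!: Max_ge)
    have P: "?P \<ge> 1"
      by (intro prod_ge_1) auto
    have T: "h * ?P \<ge> 1"
      using mult_mono[OF h(1) P] by simp
    have y: "?y (k - 1) \<in> carrier_vec (D (k - 1))"
      using compose_upto_Some(2)[of n g D x "k - 1"] g x k by auto
    \<comment> \<open>The input of layer \<open>k\<close> depends only on the networks 1 to k - 1,
      all of which precede layer \<open>n\<close> and so satisfy a growth bound.\<close>
    have "ennreal (eucl_norm (?y (k - 1))) \<le> ?P * (of_nat (k - 1) * h + ennreal (eucl_norm x))"
      using g gr x h(2) k by (intro compose_upto_growth[of n g D "k - 1" G H]) auto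
    \<comment> \<open>Including 1 in the maximum gives h >= 1; enlarging the norm of
      \<open>x\<close> by \<open>h\<close> lets \<open>h\<close> leave the sum and join
      \<open>?P\<close>, matching the argument of \<open>epow\<close> in the hypothesis on
      \<open>c\<close>.\<close>
    also have "\<dots> \<le> ?P * (of_nat n * h + h * ennreal (eucl_norm x))"
    proof (intro mult_left_mono add_mono mult_right_mono)
      show "ennreal (eucl_norm x) \<le> h * ennreal (eucl_norm x)"
        using mult_right_mono[OF h(1), of "ennreal (eucl_norm x)"] by simp
    qed (use k in auto)
    also have "\<dots> = h * ?P * ennreal (n + eucl_norm x)"
      by (simp add: algebra_simps ennreal_of_nat_eq_real_of_nat)
    finally have growth: "ennreal (eucl_norm (?y (k - 1))) \<le> h * ?P * ennreal (n + eucl_norm x)" .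
    have "ennreal (1 + rpow (eucl_norm (?y (k - 1))) \<kappa>) \<le> epow (h * ?P) \<kappa> * ennreal ?E"
      by (rule one_plus_rpow_le_epow[OF eucl_norm_nonneg eucl_norm_nonneg T _ \<open>\<kappa> \<ge> 0\<close> growth])
         (use \<open>n \<ge> 1\<close> in simp)
    then have "ennreal (eucl_norm (the (f k (?y (k - 1))) - the (g k (?y (k - 1))))) \<le>
        ennreal \<delta> * (epow (h * ?P) \<kappa> * ennreal ?E)"
    proof -
      have "ennreal (eucl_norm (the (f k (?y (k - 1))) - the (g k (?y (k - 1))))) \<le>
          ennreal \<delta> * ennreal (1 + rpow (eucl_norm (?y (k - 1))) \<kappa>)"
        using err[OF k y] \<open>\<delta> \<ge> 0\<close> by (subst ennreal_mult[symmetric]) (auto simp del: ennreal_plus intro!: ennreal_leI)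
      also have "\<dots> \<le> ennreal \<delta> * (epow (h * ?P) \<kappa> * ennreal ?E)"
        by (rule mult_left_mono) (fact, simp)
      finally show ?thesis .
    qed
    then have "(\<Prod>l\<in>{k+1..n}. L l) *
        ennreal (eucl_norm (the (f k (?y (k - 1))) - the (g k (?y (k - 1))))) \<le>
        (\<Prod>l\<in>{k+1..n}. L l) * (ennreal \<delta> * (epow (h * ?P) \<kappa> * ennreal ?E))"
      by (rule mult_left_mono) simp
    also have "\<dots> = ((\<Prod>l\<in>{k+1..n}. L l) * epow (h * ?P) \<kappa>) * (ennreal \<delta> * ennreal ?E)"
      by (simp only: mult_ac)
    also have "\<dots> \<le> ennreal c * (ennreal \<delta> * ennreal ?E)"
      using c[OF k] by (intro mult_right_mono) (simp_all only: h_def zero_le)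
    also have "\<dots> = ennreal b"
      unfolding b_def using \<open>\<delta> \<ge> 0\<close> \<open>c \<ge> 0\<close> by (simp add: ennreal_mult'' ennreal_mult)
    finally show ?thesis .
  qed
  have "ennreal (eucl_norm (the (compose_upto f n x) - the (compose_upto g n x))) \<le>
      (\<Sum>k\<in>{1..n}. (\<Prod>l\<in>{k+1..n}. L l) *
      ennreal (eucl_norm (the (f k (?y (k - 1))) - the (g k (?y (k - 1))))))"
    using f g L x by (intro compose_upto_error[of n f D g L x n]) auto
  also have "\<dots> \<le> (\<Sum>k\<in>{1..n}. ennreal b)"
    by (intro sum_mono summand)
  also have "\<dots> = ennreal (n * b)"
    using \<open>b \<ge> 0\<close> by (simp add: ennreal_mult ennreal_of_nat_eq_real_of_nat)
  finally have "eucl_norm (the (compose_upto f n x) - the (compose_upto g n x)) \<le> n * b"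
    using \<open>b \<ge> 0\<close> by (simp add: ennreal_le_iff)
  then show ?thesis
    by (simp add: b_def mult_ac)
qed

section \<open>Products of powers of dimensions\<close>

lemma prod_lessThan_add:
  fixes f :: "nat \<Rightarrow> 'a::comm_monoid_mult"
  shows "(\<Prod>l<m + n. f l) = (\<Prod>l<m. f l) * (\<Prod>l<n. f (m + l))"
  by (induction n) (simp_all add: mult.assoc)

lemma dim_prod_append:
  assumes "length ds = length rs"
  shows "dim_prod (ds @ es) (rs @ ss) = dim_prod ds rs * dim_prod es ss"
proof -
  have "dim_prod (ds @ es) (rs @ ss) =
      (\<Prod>l<length rs. real ((ds @ es) ! l) powr ((rs @ ss) ! l)) *
      (\<Prod>l<length ss. real ((ds @ es) ! (length rs + l)) powr ((rs @ ss) ! (length rs + l)))"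
    unfolding dim_prod_def length_append
    by (rule prod_lessThan_add)
  also have "\<dots> = dim_prod ds rs * dim_prod es ss"
    unfolding dim_prod_def using assms
    by (intro arg_cong2[of _ _ _ _ "(*)"] prod.cong) (auto simp: nth_append)
  finally show ?thesis .
qed

lemma dim_prod_ge_1:
  assumes "length ds = length rs" "\<forall>k\<in>set ds. k \<ge> 1" "\<forall>t\<in>set rs. t \<ge> 0"
  shows "dim_prod ds rs \<ge> 1"
  unfolding dim_prod_def using assms by (intro prod_ge_1 ge_one_powr_ge_zero) auto

text \<open>Linear relations between exponent lists become multiplicative relations between
  dimension factors, which is how the exponents \<open>R\<close> and \<open>S\<close> are
  assembled.\<close>

lemma dim_prod_linear:
  assumes "length rs = length ts" "length ss = length ts"
    "\<forall>l<length ts. ts ! l = c * rs ! l + c' * ss ! l"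
  shows "dim_prod ds ts = dim_prod ds rs powr c * dim_prod ds ss powr c'"
proof -
  have "dim_prod ds rs powr c = (\<Prod>l<length ts. real (ds ! l) powr (c * rs ! l))"
    "dim_prod ds ss powr c' = (\<Prod>l<length ts. real (ds ! l) powr (c' * ss ! l))"
    using assms(1,2) by (simp_all add: dim_prod_def prod_powr_distrib powr_powr mult.commute)
  moreover have "dim_prod ds ts =
      (\<Prod>l<length ts. real (ds ! l) powr (c * rs ! l) * real (ds ! l) powr (c' * ss ! l))"
    using assms(3) by (simp add: dim_prod_def powr_add)
  ultimately show ?thesis
    by (simp add: prod.distrib)
qed

section \<open>The composition theorem\<close>

text \<open>To be read with \<open>p\<close>, \<open>g\<close> and \<open>b\<close> as the dimension
  factors for \<open>\<alpha>\<close>, \<open>\<gamma>\<close> and \<open>\<beta>\<close>. The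
  accuracy occurs in the error as \<open>\<delta> powr (- \<rho>) * \<delta>\<close>, which is
  \<open>\<epsilon> / Q\<close> by the choice of \<open>\<delta>\<close>; \<open>Q\<close> collects
  everything else.\<close>

lemma balanced_error:
  fixes \<epsilon> :: real
  assumes "\<rho> < 1" "\<kappa> \<ge> 0" "\<epsilon> > 0" "n > 0" "n \<le> c2 * p" "c1 > 0" "c2 > 0" "p > 0" "b > 0" "g > 0"
    and Q: "Q = c1 * 2 * 2 powr \<kappa> * c2 powr (\<kappa> + 1) * (p powr (\<kappa> + 1) * g) * b"
    and \<delta>: "\<delta> = (\<epsilon> / Q) powr (1 / (1 - \<rho>))"
  shows "n * (c1 * (\<delta> powr (- \<rho>) * b * g)) * \<delta> * (2 * (2 * n) powr \<kappa>) \<le> \<epsilon>"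
proof -
  have "Q > 0"
    unfolding Q using assms by simp
  then have "\<delta> > 0"
    unfolding \<delta> using assms by simp
  have "\<delta> powr (- \<rho>) * \<delta> = \<delta> powr (1 - \<rho>)"
    using \<open>\<delta> > 0\<close> by (simp add: powr_diff powr_minus divide_simps)
  also have "\<dots> = \<epsilon> / Q"
    unfolding \<delta> using assms(1,3) \<open>Q > 0\<close> by (simp add: powr_powr)
  finally have 1: "\<delta> powr (- \<rho>) * \<delta> = \<epsilon> / Q" .
  \<comment> \<open>One power of \<open>n\<close> counts the layers, the others come from the
    weight; together they explain the exponent \<open>(\<kappa> + 1)\<close> on the factor for
    \<open>\<alpha>\<close>.\<close>
  have "n * n powr \<kappa> = n powr (\<kappa> + 1)"
    using \<open>n > 0\<close> by (simp add: powr_add)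
  also have "\<dots> \<le> (c2 * p) powr (\<kappa> + 1)"
    using assms by (intro powr_mono2) auto
  finally have 2: "n * n powr \<kappa> \<le> c2 powr (\<kappa> + 1) * p powr (\<kappa> + 1)"
    using assms by (simp add: powr_mult)
  have "n * (c1 * (\<delta> powr (- \<rho>) * b * g)) * \<delta> * (2 * (2 * n) powr \<kappa>) =
      (c1 * 2 * 2 powr \<kappa> * g * b * (\<delta> powr (- \<rho>) * \<delta>)) * (n * n powr \<kappa>)"
    using assms by (simp add: powr_mult mult_ac)
  also have "\<dots> \<le> (c1 * 2 * 2 powr \<kappa> * g * b * (\<epsilon> / Q)) * (c2 powr (\<kappa> + 1) * p powr (\<kappa> + 1))"
    unfolding 1 using assms \<open>Q > 0\<close> by (intro mult_left_mono 2) auto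
  also have "\<dots> = Q * (\<epsilon> / Q)"
    unfolding Q by (simp only: mult_ac)
  also have "\<dots> = \<epsilon>"
    using \<open>Q > 0\<close> by simp
  finally show ?thesis .
qed

text \<open>The square stems from the quadratic parameter count of the merged network. Expressing
  \<open>\<delta>\<close> through \<open>\<epsilon>\<close> turns its exponent \<open>- r0\<close>
  into the exponent \<open>2 * r0 / (1 - \<rho>)\<close> of the conclusion.\<close>

lemma powr_neg_balanced:
  fixes \<epsilon> :: real
  assumes "\<rho> < 1" "\<epsilon> > 0" "C > 0" "u > 0" "b > 0"
  shows "(((\<epsilon> / (C * u * b)) powr (1 / (1 - \<rho>))) powr (- r0))\<^sup>2 =
    C powr (2 * r0 / (1 - \<rho>)) * \<epsilon> powr (- (2 * r0 / (1 - \<rho>))) *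
    u powr (2 * r0 / (1 - \<rho>)) * b powr (2 * r0 / (1 - \<rho>))"
proof -
  have "(((\<epsilon> / (C * u * b)) powr (1 / (1 - \<rho>))) powr (- r0))\<^sup>2 =
      (\<epsilon> / (C * u * b)) powr (- (2 * r0 / (1 - \<rho>)))"
    unfolding power2_eq_square powr_add[symmetric] powr_powr by (simp add: field_simps)
  also have "\<dots> = \<epsilon> powr (- (2 * r0 / (1 - \<rho>))) * (C * u * b) powr (2 * r0 / (1 - \<rho>))"
    using assms by (simp add: powr_divide powr_minus divide_simps)
  finally show ?thesis
    using assms by (simp add: powr_mult mult_ac)
qed

section \<open>Constants from suprema, networks from approximation spaces\<close>

lemma ennreal_le_mult_if_divide_le:
  fixes X :: ennreal
  assumes "X / ennreal b \<le> s" "b > 0"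
  shows "X \<le> s * ennreal b"
proof -
  have "X = X / ennreal b * ennreal b"
    using assms(2) by (simp add: ennreal_divide_times ennreal_divide_self)
  also have "\<dots> \<le> s * ennreal b"
    by (intro mult_right_mono assms) simp
  finally show ?thesis .
qed

lemma ennreal_enn2real_le_max:
  assumes "s < \<infinity>"
  shows "s \<le> ennreal (max 1 (enn2real s))"
proof -
  have "s = ennreal (enn2real s)"
    using assms by simp
  also have "\<dots> \<le> ennreal (max 1 (enn2real s))"
    by (intro ennreal_leI) simp
  finally show ?thesis .
qed

text \<open>In \<open>approx_space\<close> the typing and the parameter bound stand under the
  quantifier over \<open>x\<close>. Every carrier contains its zero vector, so evaluating there
  frees them.\<close>

lemma approx_spaceE:
  assumes "f \<in> approx_space a w G H r0 rs I d"
  obtains K where "\<forall>i\<in>I. \<forall>\<epsilon>\<in>{0<..1}. \<exists>\<Phi>\<in>ANN. \<exists>m m'.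
    f i \<in> C_space m m' \<and> realization a \<Phi> \<in> C_space m m' \<and>
    real (num_params \<Phi>) \<le> K * \<epsilon> powr (- r0) * dim_prod (d i) rs \<and>
    (\<forall>x\<in>carrier_vec m. w (eucl_norm x) * eucl_norm (the (f i x) - the (realization a \<Phi> x)) \<le> \<epsilon> \<and>
      ennreal (eucl_norm (the (realization a \<Phi> x))) \<le> G i \<epsilon> * (H i \<epsilon> + ennreal (eucl_norm x)))"
proof -
  obtain K where K: "\<And>i \<epsilon>. i \<in> I \<Longrightarrow> \<epsilon> \<in> {0<..1} \<Longrightarrow> \<exists>\<Phi>\<in>ANN. \<exists>m\<ge>1. \<exists>n\<ge>1. \<forall>x\<in>carrier_vec m.
      {f i, realization a \<Phi>} \<subseteq> C_space m n \<and>
      real (num_params \<Phi>) \<le> K * \<epsilon> powr (- r0) * dim_prod (d i) rs \<and>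
      w (eucl_norm x) * eucl_norm (the (f i x) - the (realization a \<Phi> x)) \<le> \<epsilon> \<and>
      ennreal (eucl_norm (the (realization a \<Phi> x))) \<le> G i \<epsilon> * (H i \<epsilon> + ennreal (eucl_norm x))"
    using assms unfolding approx_space_def mem_Collect_eq by (elim conjE exE) (rule that, blast)
  show thesis
  proof (rule that[of K], intro ballI)
    fix i \<epsilon> assume "i \<in> I" "\<epsilon> \<in> {0<..(1::real)}"
    from K[OF this] obtain \<Phi> m n where *: "\<Phi> \<in> ANN" "\<forall>x\<in>carrier_vec m.
      {f i, realization a \<Phi>} \<subseteq> C_space m n \<and>
      real (num_params \<Phi>) \<le> K * \<epsilon> powr (- r0) * dim_prod (d i) rs \<and>
      w (eucl_norm x) * eucl_norm (the (f i x) - the (realization a \<Phi> x)) \<le> \<epsilon> \<and>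
      ennreal (eucl_norm (the (realization a \<Phi> x))) \<le> G i \<epsilon> * (H i \<epsilon> + ennreal (eucl_norm x))"
      by blast
    from *(2)[rule_format, of "0\<^sub>v m"] * show "\<exists>\<Phi>\<in>ANN. \<exists>m m'.
      f i \<in> C_space m m' \<and> realization a \<Phi> \<in> C_space m m' \<and>
      real (num_params \<Phi>) \<le> K * \<epsilon> powr (- r0) * dim_prod (d i) rs \<and>
      (\<forall>x\<in>carrier_vec m. w (eucl_norm x) * eucl_norm (the (f i x) - the (realization a \<Phi> x)) \<le> \<epsilon> \<and>
        ennreal (eucl_norm (the (realization a \<Phi> x))) \<le> G i \<epsilon> * (H i \<epsilon> + ennreal (eucl_norm x)))"
      by (intro bexI[of _ \<Phi>] exI[of _ m] exI[of _ n]) auto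
  qed
qed

lemma approx_space_infI:
  assumes "\<And>i. i \<in> I \<Longrightarrow> m i \<ge> 1 \<and> m' i \<ge> 1 \<and> f i \<in> C_space (m i) (m' i)"
    and "\<And>i \<epsilon>. i \<in> I \<Longrightarrow> \<epsilon> \<in> {0<..1} \<Longrightarrow> \<exists>\<Phi>\<in>ANN. realization a \<Phi> \<in> C_space (m i) (m' i) \<and>
      real (num_params \<Phi>) \<le> K * \<epsilon> powr (- r0) * dim_prod (d i) rs \<and>
      (\<forall>x\<in>carrier_vec (m i). w (eucl_norm x) *
        eucl_norm (the (f i x) - the (realization a \<Phi> x)) \<le> \<epsilon>)"
  shows "f \<in> approx_space a w (\<lambda>_ _. \<infinity>) (\<lambda>_ _. \<infinity>) r0 rs I d"
  unfolding approx_space_def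
proof (rule CollectI, intro conjI exI[of _ K] ballI)
  show "function_family I f"
    unfolding function_family_def using assms(1) by fastforce
next
  fix i \<epsilon> assume i: "i \<in> I" and "\<epsilon> \<in> {0<..(1::real)}"
  from assms(2)[OF this] obtain \<Phi> where "\<Phi> \<in> ANN" "realization a \<Phi> \<in> C_space (m i) (m' i)"
    "real (num_params \<Phi>) \<le> K * \<epsilon> powr (- r0) * dim_prod (d i) rs"
    "\<forall>x\<in>carrier_vec (m i). w (eucl_norm x) *
      eucl_norm (the (f i x) - the (realization a \<Phi> x)) \<le> \<epsilon>"
    by blast
  then show "\<exists>\<Phi>\<in>ANN. \<exists>m\<ge>1. \<exists>n\<ge>1. \<forall>x\<in>carrier_vec m.
      {f i, realization a \<Phi>} \<subseteq> C_space m n \<and>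
      real (num_params \<Phi>) \<le> K * \<epsilon> powr (- r0) * dim_prod (d i) rs \<and>
      w (eucl_norm x) * eucl_norm (the (f i x) - the (realization a \<Phi> x)) \<le> \<epsilon> \<and>
      ennreal (eucl_norm (the (realization a \<Phi> x))) \<le> \<infinity> * (\<infinity> + ennreal (eucl_norm x))"
    using assms(1)[OF i]
    by (intro bexI[of _ \<Phi>] exI[of _ "m i"] exI[of _ "m' i"] conjI) auto
qed

theorem proposition3p18:
  fixes N M :: nat
    and I :: "'i set" and J :: "'j set"
    and d :: "'i \<Rightarrow> nat list" and e :: "'j \<Rightarrow> nat list"
    and \<kappa> r0 \<rho> :: real
    and r s \<alpha> \<beta> \<gamma> R S :: "real list"
    and n :: "'j \<Rightarrow> nat"
    and A B :: "('i \<times> 'j \<times> nat) set"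
    and L :: "'i \<times> 'j \<times> nat \<Rightarrow> ennreal"
    and G H :: "'i \<times> 'j \<times> nat \<Rightarrow> real \<Rightarrow> ennreal"
    and a w :: "real \<Rightarrow> real"
    and In Out :: "'i \<times> 'j \<times> nat \<Rightarrow> nat"
    and f :: "'j \<Rightarrow> nat \<Rightarrow> 'i \<Rightarrow> real vec \<rightharpoonup> real vec"
  assumes "N \<ge> 1" and "M \<ge> 1" and "I \<noteq> {}" and "J \<noteq> {}"
    and "dim_mapping N I d" and "dim_mapping M J e"
    and "length r = N" and "length \<beta> = N" and "length R = N"
    and "length s = M" and "length \<alpha> = M" and "length \<gamma> = M" and "length S = M"
    and "\<kappa> \<ge> 0" and "r0 \<ge> 0"
    and "\<forall>t \<in> set r \<union> set s \<union> set \<alpha> \<union> set \<beta> \<union> set \<gamma> \<union> set R \<union> set S. t \<ge> 0"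
    and "0 \<le> \<rho>" and "\<rho> < 1"
    and "\<forall>j\<in>J. n j \<ge> 2"
    and "A = {(i, j, k). i \<in> I \<and> j \<in> J \<and> 1 \<le> k \<and> k \<le> n j}"
    and "B = {(i, j, k) \<in> A. k \<le> n j - 1}"
    and "\<forall>p\<in>A. L p > 0"
    and "\<forall>p\<in>B. \<forall>\<epsilon>\<in>{0<..1}. G p \<epsilon> > 0"
    and "\<forall>p\<in>B. \<forall>\<epsilon>\<in>{0<..1}. H p \<epsilon> > 0"
    and "continuous_on UNIV a"
    and "\<forall>l<N. R ! l = 2 * r ! l + 2 * r0 * \<beta> ! l / (1 - \<rho>)"
    and "\<forall>l<M. S ! l = 2 * s ! l + \<alpha> ! l + 2 * r0 * ((\<kappa> + 1) * \<alpha> ! l + \<gamma> ! l) / (1 - \<rho>)"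
    and "(SUP (i, j, k)\<in>A. SUP \<epsilon>\<in>{0<..1}.
            (\<Prod>l\<in>{k+1..n j}. L (i, j, l)) *
            epow (Max ({H (i, j, l) \<epsilon> |l. 0 < l \<and> l < k} \<union> {1}) *
                  (\<Prod>l\<in>{1..k-1}. max (G (i, j, l) \<epsilon>) 1)) \<kappa> /
            ennreal (\<epsilon> powr (- \<rho>) * dim_prod (d i) \<beta> * dim_prod (e j) \<gamma>)) +
         (SUP j\<in>J. ennreal (real (n j) / dim_prod (e j) \<alpha>)) < \<infinity>"
    and "\<forall>v\<ge>0. w v = inverse (1 + rpow v \<kappa>)"
    and "\<forall>p\<in>A. In p \<ge> 1" and "\<forall>p\<in>A. Out p \<ge> 1"
    and "\<forall>(i, j, k)\<in>B. Out (i, j, k) = In (i, j, k + 1)"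
    and "\<forall>j\<in>J. \<forall>k\<in>{1..n j}. function_family I (f j k)"
    and "\<forall>j\<in>J. \<forall>k\<in>{1..n j}. \<forall>i\<in>I. f j k i \<in> C_space (In (i, j, k)) (Out (i, j, k))"
    and "\<forall>j\<in>J. \<forall>k\<in>{1..n j}. \<forall>i\<in>I.
           \<forall>x\<in>carrier_vec (In (i, j, k)). \<forall>y\<in>carrier_vec (In (i, j, k)).
             ennreal (eucl_norm (the (f j k i x) - the (f j k i y)))
               \<le> L (i, j, k) * ennreal (eucl_norm (x - y))"
    and "(\<lambda>(i, j). f j (n j) i)
           \<in> approx_space a w (\<lambda>_ _. \<infinity>) (\<lambda>_ _. \<infinity>) r0 (r @ s) (I \<times> J) (dim_tensor d e)"
    and "(\<lambda>(i, j, k). f j k i)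
           \<in> approx_space a w G H r0 (r @ s @ [0]) B (dim_tensor d (dim_tensor e dim_id))"
  shows "(\<lambda>(i, j). compose_upto (\<lambda>k. f j k i) (n j))
           \<in> approx_space a w (\<lambda>_ _. \<infinity>) (\<lambda>_ _. \<infinity>) (2 * r0 / (1 - \<rho>)) (R @ S)
               (I \<times> J) (dim_tensor d e)"
proof -

  \<comment> \<open>Uniform constants and dimension factors\<close>
  define s1 where "s1 = (SUP (i, j, k)\<in>A. SUP \<epsilon>\<in>{0<..1}.
      (\<Prod>l\<in>{k+1..n j}. L (i, j, l)) *
      epow (Max ({H (i, j, l) \<epsilon> |l. 0 < l \<and> l < k} \<union> {1}) *
            (\<Prod>l\<in>{1..k-1}. max (G (i, j, l) \<epsilon>) 1)) \<kappa> /
      ennreal (\<epsilon> powr (- \<rho>) * dim_prod (d i) \<beta> * dim_prod (e j) \<gamma>))"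
  define s2 where "s2 = (SUP j\<in>J. ennreal (real (n j) / dim_prod (e j) \<alpha>))"
  have "s1 + s2 < \<infinity>"
    using assms(28) unfolding s1_def s2_def .
  then have fin: "s1 < \<infinity>" "s2 < \<infinity>"
    by (auto simp: less_top)
  \<comment> \<open>Raising the finite suprema to at least 1 keeps the constants positive and later
    gives \<open>C\<close> >= 1.\<close>
  define c1 c2 where "c1 = max 1 (enn2real s1)" and "c2 = max 1 (enn2real s2)"
  have c: "c1 \<ge> 1" "c2 \<ge> 1" "s1 \<le> ennreal c1" "s2 \<le> ennreal c2"
    using fin by (auto simp: c1_def c2_def less_top intro: ennreal_enn2real_le_max)
  \<comment> \<open>\<open>U\<close> holds the exponents with which the dimensions on
    \<open>J\<close> enter the error constant. \<open>V\<close> holds those of the parameter count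
    apart from the accuracy: twice \<open>s\<close> from squaring, \<open>\<alpha>\<close> from the
    number of layers. Thus \<open>S\<close> is \<open>V\<close> plus
    \<open>2 * r0 / (1 - \<rho>)\<close> times \<open>U\<close>.\<close>
  define U V where "U = map (\<lambda>l. (\<kappa> + 1) * \<alpha> ! l + \<gamma> ! l) [0..<M]"
    and "V = map (\<lambda>l. 2 * s ! l + \<alpha> ! l) [0..<M]"
  have d: "length (d i) = N" "\<forall>k\<in>set (d i). k \<ge> 1" if "i \<in> I" for i
    using assms(5) that by (auto simp: dim_mapping_def)
  have e: "length (e j) = M" "\<forall>k\<in>set (e j). k \<ge> 1" if "j \<in> J" for j
    using assms(6) that by (auto simp: dim_mapping_def)
  have dR: "dim_prod (d i) R = dim_prod (d i) r powr 2 * dim_prod (d i) \<beta> powr (2 * r0 / (1 - \<rho>))"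
    for i using assms(7-9,26) by (intro dim_prod_linear) auto
  have eU: "dim_prod (e j) U = dim_prod (e j) \<alpha> powr (\<kappa> + 1) * dim_prod (e j) \<gamma> powr 1" for j
    using assms(11,12) by (intro dim_prod_linear) (auto simp: U_def)
  have eV: "dim_prod (e j) V = dim_prod (e j) s powr 2 * dim_prod (e j) \<alpha> powr 1" for j
    using assms(10,11) by (intro dim_prod_linear) (auto simp: V_def)
  have eS: "dim_prod (e j) S = dim_prod (e j) V powr 1 * dim_prod (e j) U powr (2 * r0 / (1 - \<rho>))"
    for j using assms(13,27) by (intro dim_prod_linear) (auto simp: U_def V_def)
  have ge_1: "dim_prod (d i) r \<ge> 1" "dim_prod (d i) \<beta> \<ge> 1" if "i \<in> I" for i
    using assms(7,8,16) d[OF that] by (auto intro!: dim_prod_ge_1)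
  have ge_1': "dim_prod (e j) s \<ge> 1" "dim_prod (e j) \<alpha> \<ge> 1" "dim_prod (e j) \<gamma> \<ge> 1" if "j \<in> J" for j
    using assms(10,11,12,16) e[OF that] by (auto intro!: dim_prod_ge_1)
  have n_le: "n j \<le> c2 * dim_prod (e j) \<alpha>" if j: "j \<in> J" for j
  proof -
    have "ennreal (n j / dim_prod (e j) \<alpha>) \<le> s2"
      unfolding s2_def using j by (rule SUP_upper)
    also note c(4)
    finally have "n j / dim_prod (e j) \<alpha> \<le> c2"
      using c(2) by (simp add: ennreal_le_iff)
    then show ?thesis
      using ge_1'(2)[OF j] by (simp add: divide_simps)
  qed
  have amplification: "(\<Prod>l\<in>{k+1..n j}. L (i, j, l)) *
      epow (Max ({H (i, j, l) \<delta> |l. 0 < l \<and> l < k} \<union> {1}) *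
            (\<Prod>l\<in>{1..k-1}. max (G (i, j, l) \<delta>) 1)) \<kappa> \<le>
      ennreal (c1 * (\<delta> powr (- \<rho>) * dim_prod (d i) \<beta> * dim_prod (e j) \<gamma>))" (is "?X \<le> _")
    if ijk: "i \<in> I" "j \<in> J" "k \<in> {1..n j}" and \<delta>: "\<delta> \<in> {0<..1}" for i j k \<delta>
  proof -
    let ?b = "\<delta> powr (- \<rho>) * dim_prod (d i) \<beta> * dim_prod (e j) \<gamma>"
    have "?b > 0"
      using \<delta> ge_1[OF ijk(1)] ge_1'[OF ijk(2)] by auto
    have "(i, j, k) \<in> A"
      using ijk assms(20) by auto
    then have "?X / ennreal ?b \<le> s1"
      unfolding s1_def using \<delta> by (intro SUP_upper2[of "(i, j, k)"]) (auto intro!: SUP_upper2[of \<delta>])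
    also note c(3)
    finally have "?X \<le> ennreal c1 * ennreal ?b"
      using \<open>?b > 0\<close> by (rule ennreal_le_mult_if_divide_le)
    then show ?thesis
      using c(1) by (subst ennreal_mult') simp_all
  qed

  \<comment> \<open>Approximation of the individual layers\<close>
  obtain K1 where K1: "\<forall>p\<in>I \<times> J. \<forall>\<epsilon>\<in>{0<..1}. \<exists>\<Phi>\<in>ANN. \<exists>m m'.
      (\<lambda>(i, j). f j (n j) i) p \<in> C_space m m' \<and> realization a \<Phi> \<in> C_space m m' \<and>
      real (num_params \<Phi>) \<le> K1 * \<epsilon> powr (- r0) * dim_prod (dim_tensor d e p) (r @ s) \<and>
      (\<forall>x\<in>carrier_vec m. w (eucl_norm x) *
        eucl_norm (the ((\<lambda>(i, j). f j (n j) i) p x) - the (realization a \<Phi> x)) \<le> \<epsilon> \<and>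
        ennreal (eucl_norm (the (realization a \<Phi> x))) \<le> \<infinity> * (\<infinity> + ennreal (eucl_norm x)))"
    by (rule approx_spaceE[OF assms(36)]) (rule that)
  obtain K2 where K2: "\<forall>p\<in>B. \<forall>\<epsilon>\<in>{0<..1}. \<exists>\<Phi>\<in>ANN. \<exists>m m'.
      (\<lambda>(i, j, k). f j k i) p \<in> C_space m m' \<and> realization a \<Phi> \<in> C_space m m' \<and>
      real (num_params \<Phi>) \<le>
        K2 * \<epsilon> powr (- r0) * dim_prod (dim_tensor d (dim_tensor e dim_id) p) (r @ s @ [0]) \<and>
      (\<forall>x\<in>carrier_vec m. w (eucl_norm x) *
        eucl_norm (the ((\<lambda>(i, j, k). f j k i) p x) - the (realization a \<Phi> x)) \<le> \<epsilon> \<and>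
        ennreal (eucl_norm (the (realization a \<Phi> x))) \<le> G p \<epsilon> * (H p \<epsilon> + ennreal (eucl_norm x)))"
    by (rule approx_spaceE[OF assms(37)]) (rule that)
  \<comment> \<open>A common constant for the last layers and the earlier ones, which are
    approximated in different spaces.\<close>
  define K where "K = max K1 K2"
  \<comment> \<open>The weight is the reciprocal of a polynomial, so a weighted error bound is an
    error bound with polynomial growth.\<close>
  have unweight: "z \<le> \<epsilon> * (1 + rpow (eucl_norm x) \<kappa>)" if "w (eucl_norm x) * z \<le> \<epsilon>" for z \<epsilon> x
  proof -
    have "1 + rpow (eucl_norm x) \<kappa> > 0"
      by (intro add_pos_nonneg) auto
    then show ?thesis
      using that assms(29) by (simp add: field_simps)
  qed
  \<comment> \<open>The chain of dimensions: the input of the first layer, then the output of each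
    layer. The matching condition on \<open>B\<close> makes each later input equal to the preceding
    output.\<close>
  define D where "D i j k = (if k = 0 then In (i, j, 1) else Out (i, j, k))" for i j k
  have D_ge_1: "D i j k \<ge> 1" if "i \<in> I" "j \<in> J" "k \<le> n j" for i j k
  proof -
    have "n j \<ge> 1"
      using assms(19) that by auto
    then show ?thesis
      using that assms(20,30,31) by (auto simp: D_def)
  qed
  have D_In: "D i j (k - 1) = In (i, j, k)" "D i j k = Out (i, j, k)"
    if "i \<in> I" "j \<in> J" "k \<in> {1..n j}" for i j k
  proof -
    show "D i j (k - 1) = In (i, j, k)"
    proof (cases "k = 1")
      case False
      then have "(i, j, k - 1) \<in> B"
        using that assms(20,21) by auto
      then show ?thesis
        using that False assms(32) by (fastforce simp: D_def)
    qed (simp add: D_def)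
    show "D i j k = Out (i, j, k)"
      using that by (simp add: D_def)
  qed
  have f: "f j k i \<in> C_space (D i j (k - 1)) (D i j k)"
    if "i \<in> I" "j \<in> J" "k \<in> {1..n j}" for i j k
    using assms(34)[rule_format, OF that(2,3,1)] unfolding D_In[OF that] .
  have lip: "ennreal (eucl_norm (the (f j k i x) - the (f j k i y))) \<le>
      L (i, j, k) * ennreal (eucl_norm (x - y))"
    if "i \<in> I" "j \<in> J" "k \<in> {1..n j}" "x \<in> carrier_vec (D i j (k - 1))" "y \<in> carrier_vec (D i j (k - 1))"
    for i j k x y
    using assms(35)[rule_format, OF that(2,3,1)] that(4,5) unfolding D_In(1)[OF that(1-3)] by blast
  have layer: "\<exists>\<Phi>\<in>ANN. realization a \<Phi> \<in> C_space (D i j (k - 1)) (D i j k) \<and>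
      num_params \<Phi> \<le> K * \<delta> powr (- r0) * (dim_prod (d i) r * dim_prod (e j) s) \<and>
      (\<forall>x\<in>carrier_vec (D i j (k - 1)).
        eucl_norm (the (f j k i x) - the (realization a \<Phi> x)) \<le> \<delta> * (1 + rpow (eucl_norm x) \<kappa>) \<and>
        (k < n j \<longrightarrow> ennreal (eucl_norm (the (realization a \<Phi> x))) \<le>
          G (i, j, k) \<delta> * (H (i, j, k) \<delta> + ennreal (eucl_norm x))))"
    if ijk: "i \<in> I" "j \<in> J" "k \<in> {1..n j}" and \<delta>: "\<delta> \<in> {0<..1}" for i j k \<delta>
  proof -
    let ?P = "dim_prod (d i) r * dim_prod (e j) s"
    obtain \<Phi> K0 m m' where \<Phi>: "\<Phi> \<in> ANN" "K0 \<le> K" "f j k i \<in> C_space m m'" "realization a \<Phi> \<in> C_space m m'"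
      "real (num_params \<Phi>) \<le> K0 * \<delta> powr (- r0) * ?P"
      "\<forall>x\<in>carrier_vec m. w (eucl_norm x) * eucl_norm (the (f j k i x) - the (realization a \<Phi> x)) \<le> \<delta> \<and>
        (k < n j \<longrightarrow> ennreal (eucl_norm (the (realization a \<Phi> x))) \<le>
          G (i, j, k) \<delta> * (H (i, j, k) \<delta> + ennreal (eucl_norm x)))"
    proof (cases "k = n j")
      case True
      have "(i, j) \<in> I \<times> J"
        using ijk by simp
      from K1[rule_format, OF this \<delta>] obtain \<Phi> m m' where \<Phi>: "\<Phi> \<in> ANN" "f j k i \<in> C_space m m'"
        "realization a \<Phi> \<in> C_space m m'"
        "real (num_params \<Phi>) \<le> K1 * \<delta> powr (- r0) * dim_prod (dim_tensor d e (i, j)) (r @ s)"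
        "\<forall>x\<in>carrier_vec m. w (eucl_norm x) * eucl_norm (the (f j k i x) - the (realization a \<Phi> x)) \<le> \<delta>"
        unfolding True prod.case by blast
      have "dim_prod (dim_tensor d e (i, j)) (r @ s) = ?P"
        using d(1)[OF ijk(1)] assms(7) by (simp add: dim_tensor_def dim_prod_append)
      with \<Phi> True show thesis
        by (intro that[of \<Phi> K1 m m']) (auto simp: K_def)
    next
      case False
      then have "(i, j, k) \<in> B"
        using ijk assms(20,21) by auto
      from K2[rule_format, OF this \<delta>] obtain \<Phi> m m' where \<Phi>: "\<Phi> \<in> ANN" "f j k i \<in> C_space m m'"
        "realization a \<Phi> \<in> C_space m m'"
        "real (num_params \<Phi>) \<le> K2 * \<delta> powr (- r0) *
          dim_prod (dim_tensor d (dim_tensor e dim_id) (i, j, k)) (r @ s @ [0])"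
        "\<forall>x\<in>carrier_vec m. w (eucl_norm x) * eucl_norm (the (f j k i x) - the (realization a \<Phi> x)) \<le> \<delta> \<and>
          ennreal (eucl_norm (the (realization a \<Phi> x))) \<le>
            G (i, j, k) \<delta> * (H (i, j, k) \<delta> + ennreal (eucl_norm x))"
        unfolding prod.case by blast
      \<comment> \<open>The exponent 0 makes the parameter bound independent of the layer index.
        Positivity of \<open>k\<close> enters because \<open>0 powr 0\<close> is 0.\<close>
      have "dim_prod [k] [0] = 1"
        using ijk(3) by (simp add: dim_prod_def)
      then have "dim_prod (dim_tensor d (dim_tensor e dim_id) (i, j, k)) (r @ s @ [0]) = ?P"
        using d(1)[OF ijk(1)] e(1)[OF ijk(2)] assms(7,10)
        by (simp add: dim_tensor_def dim_prod_append dim_id_def)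
      with \<Phi> show thesis
        by (intro that[of \<Phi> K2 m m']) (auto simp: K_def)
    qed
    have m: "m = D i j (k - 1)" "m' = D i j k"
      using C_space_unique[OF \<Phi>(3) f[OF ijk(1-3)]] by auto
    have "K0 * \<delta> powr (- r0) * ?P \<le> K * \<delta> powr (- r0) * ?P"
      using \<Phi>(2) ge_1[OF ijk(1)] ge_1'[OF ijk(2)] by (intro mult_right_mono) auto
    then show ?thesis
      using \<Phi>(1,4-6) unfolding m by (intro bexI[of _ \<Phi>]) (auto intro: unweight)
  qed

  \<comment> \<open>Construction of the composed network\<close>
  define C where "C = c1 * 2 * 2 powr \<kappa> * c2 powr (\<kappa> + 1)"
  have "C \<ge> 1 * 1 * 1 * 1"
    unfolding C_def using c(1,2) assms(14) by (intro mult_mono ge_one_powr_ge_zero) auto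
  then have C: "C \<ge> 1" by simp
  \<comment> \<open>The count 2 n p^2 contributes the factor 2, \<open>c2\<close> from bounding the
    number of layers, and \<open>K\<close> squared; the power of \<open>C\<close> comes from
    expressing the accuracy through \<open>\<epsilon>\<close>.\<close>
  define K' where "K' = 2 * c2 * K\<^sup>2 * C powr (2 * r0 / (1 - \<rho>))"
  have main: "\<exists>\<Psi>\<in>ANN. realization a \<Psi> \<in> C_space (D i j 0) (D i j (n j)) \<and>
      num_params \<Psi> \<le> K' * \<epsilon> powr (- (2 * r0 / (1 - \<rho>))) * dim_prod (dim_tensor d e (i, j)) (R @ S) \<and>
      (\<forall>x\<in>carrier_vec (D i j 0). w (eucl_norm x) *
        eucl_norm (the (compose_upto (\<lambda>k. f j k i) (n j) x) - the (realization a \<Psi> x)) \<le> \<epsilon>)"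
    if ij: "i \<in> I" "j \<in> J" and \<epsilon>: "\<epsilon> \<in> {0<..1}" for i j \<epsilon>
  proof -
    let ?Dr = "dim_prod (d i) r" and ?Db = "dim_prod (d i) \<beta>" and ?Ds = "dim_prod (e j) s"
      and ?Da = "dim_prod (e j) \<alpha>" and ?Dg = "dim_prod (e j) \<gamma>" and ?DU = "dim_prod (e j) U"
    have ge: "?Dr \<ge> 1" "?Db \<ge> 1" "?Ds \<ge> 1" "?Da \<ge> 1" "?Dg \<ge> 1"
      using ge_1[OF ij(1)] ge_1'[OF ij(2)] by auto
    have "?DU \<ge> 1 * 1"
      unfolding eU using ge assms(14) by (intro mult_mono ge_one_powr_ge_zero) auto
    then have DU: "?DU \<ge> 1" by simp
    have nj: "n j \<ge> 1"
      using assms(19) ij by auto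
    \<comment> \<open>The \<open>Q\<close> of \<open>balanced_error\<close>, grouped into a
      constant, a factor depending on \<open>j\<close> and a factor depending on \<open>i\<close>.
      Being at least 1, it forces \<open>\<delta>\<close> into the range of accuracies covered by
      the assumptions.\<close>
    define Q where "Q = C * ?DU * ?Db"
    have "Q \<ge> 1 * 1 * 1"
      unfolding Q_def using C DU ge by (intro mult_mono) auto
    then have Q: "Q \<ge> 1" by simp
    define \<delta> where "\<delta> = (\<epsilon> / Q) powr (1 / (1 - \<rho>))"
    have "0 < \<epsilon> / Q" "\<epsilon> / Q \<le> 1"
      using \<epsilon> Q by auto
    then have \<delta>: "\<delta> \<in> {0<..1}"
      unfolding \<delta>_def using assms(18) by (auto intro!: powr_le1)
    define p where "p = K * \<delta> powr (- r0) * (?Dr * ?Ds)"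
    define good where "good k \<Phi> \<longleftrightarrow> \<Phi> \<in> ANN \<and>
        realization a \<Phi> \<in> C_space (D i j (k - 1)) (D i j k) \<and> num_params \<Phi> \<le> p \<and>
        (\<forall>x\<in>carrier_vec (D i j (k - 1)).
          eucl_norm (the (f j k i x) - the (realization a \<Phi> x)) \<le> \<delta> * (1 + rpow (eucl_norm x) \<kappa>) \<and>
          (k < n j \<longrightarrow> ennreal (eucl_norm (the (realization a \<Phi> x))) \<le>
            G (i, j, k) \<delta> * (H (i, j, k) \<delta> + ennreal (eucl_norm x))))" for k \<Phi>
    have "\<forall>k\<in>{1..n j}. \<exists>\<Phi>. good k \<Phi>"
      using layer[OF ij _ \<delta>] unfolding good_def p_def Bex_def by (intro ballI) assumption
    from bchoice[OF this] obtain \<Phi> where good: "\<forall>k\<in>{1..n j}. good k (\<Phi> k)" ..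
    have \<Phi>: "\<Phi> k \<in> ANN" "realization a (\<Phi> k) \<in> C_space (D i j (k - 1)) (D i j k)"
      "num_params (\<Phi> k) \<le> p"
      "x \<in> carrier_vec (D i j (k - 1)) \<Longrightarrow>
        eucl_norm (the (f j k i x) - the (realization a (\<Phi> k) x)) \<le> \<delta> * (1 + rpow (eucl_norm x) \<kappa>)"
      "x \<in> carrier_vec (D i j (k - 1)) \<Longrightarrow> k < n j \<Longrightarrow>
        ennreal (eucl_norm (the (realization a (\<Phi> k) x))) \<le>
          G (i, j, k) \<delta> * (H (i, j, k) \<delta> + ennreal (eucl_norm x))"
      if "k \<in> {1..n j}" for k x
      using good[rule_format, OF that] unfolding good_def by blast+
    obtain \<Psi> where \<Psi>: "\<Psi> \<noteq> []" "ann_typed (D i j 0) \<Psi> (D i j (n j))"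
      "realization a \<Psi> = compose_upto (\<lambda>k. realization a (\<Phi> k)) (n j)"
      "num_params \<Psi> \<le> 2 * real (n j) * p\<^sup>2"
      using compose_upto_realization[of "n j" \<Phi> a "D i j" p, OF \<Phi>(1-3) nj] by blast
    have "\<Psi> \<in> ANN"
      using \<Psi>(1,2) D_ge_1[OF ij, of 0] by (auto simp: ANN_iff)
    moreover have "realization a \<Psi> \<in> C_space (D i j 0) (D i j (n j))"
      unfolding \<Psi>(3) using \<Phi>(2) nj by (rule compose_upto_C_space)
    moreover have "num_params \<Psi> \<le>
        K' * \<epsilon> powr (- (2 * r0 / (1 - \<rho>))) * dim_prod (dim_tensor d e (i, j)) (R @ S)"
    proof -
      have "p\<^sup>2 = K\<^sup>2 * (C powr (2 * r0 / (1 - \<rho>)) * \<epsilon> powr (- (2 * r0 / (1 - \<rho>))) *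
          ?DU powr (2 * r0 / (1 - \<rho>)) * ?Db powr (2 * r0 / (1 - \<rho>))) * (?Dr\<^sup>2 * ?Ds\<^sup>2)"
        unfolding p_def power_mult_distrib \<delta>_def Q_def using assms(18) \<epsilon> C DU ge
        by (subst powr_neg_balanced) auto
      moreover have "dim_prod (dim_tensor d e (i, j)) (R @ S) =
          ?Dr\<^sup>2 * ?Db powr (2 * r0 / (1 - \<rho>)) * (?Ds\<^sup>2 * ?Da * ?DU powr (2 * r0 / (1 - \<rho>)))"
        using d(1)[OF ij(1)] assms(9) ge
        by (simp add: dim_tensor_def dim_prod_append dR eS eV)
      \<comment> \<open>The two displays agree factor by factor once \<open>?Da\<close> is
        attributed to the bound on the number of layers.\<close>
      ultimately have "K' * \<epsilon> powr (- (2 * r0 / (1 - \<rho>))) *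
          dim_prod (dim_tensor d e (i, j)) (R @ S) = 2 * (c2 * ?Da) * p\<^sup>2"
        by (simp only: K'_def mult_ac)
      moreover have "2 * real (n j) * p\<^sup>2 \<le> 2 * (c2 * ?Da) * p\<^sup>2"
        using n_le[OF ij(2)] by (intro mult_right_mono) auto
      ultimately show ?thesis
        using \<Psi>(4) by linarith
    qed
    moreover have "w (eucl_norm x) *
        eucl_norm (the (compose_upto (\<lambda>k. f j k i) (n j) x) - the (realization a \<Psi> x)) \<le> \<epsilon>"
      if x: "x \<in> carrier_vec (D i j 0)" for x
    proof -
      let ?c = "c1 * (\<delta> powr (- \<rho>) * ?Db * ?Dg)" and ?x = "1 + rpow (eucl_norm x) \<kappa>"
      have "?x > 0"
        by (intro add_pos_nonneg) auto
      have "eucl_norm (the (compose_upto (\<lambda>k. f j k i) (n j) x) - the (realization a \<Psi> x)) \<le>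
          n j * ?c * \<delta> * (2 * (2 * real (n j)) powr \<kappa>) * ?x"
        unfolding \<Psi>(3)
      proof (rule compose_upto_weighted_error[where D = "D i j" and L = "\<lambda>l. L (i, j, l)" and
            G = "\<lambda>l. G (i, j, l) \<delta>" and H = "\<lambda>l. H (i, j, l) \<delta>"])
        show "f j k i \<in> C_space (D i j (k - 1)) (D i j k)" if "k \<in> {1..n j}" for k
          using f[OF ij that] .
        show "realization a (\<Phi> k) \<in> C_space (D i j (k - 1)) (D i j k)" if "k \<in> {1..n j}" for k
          using \<Phi>(2)[OF that] .
        show "ennreal (eucl_norm (the (f j k i x) - the (f j k i y))) \<le>
            L (i, j, k) * ennreal (eucl_norm (x - y))"
          if "k \<in> {1..n j}" "x \<in> carrier_vec (D i j (k - 1))" "y \<in> carrier_vec (D i j (k - 1))" for k x y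
          using lip[OF ij that] .
        show "ennreal (eucl_norm (the (realization a (\<Phi> k) x))) \<le>
            G (i, j, k) \<delta> * (H (i, j, k) \<delta> + ennreal (eucl_norm x))"
          if "1 \<le> k" "k < n j" "x \<in> carrier_vec (D i j (k - 1))" for k x
          using \<Phi>(5)[of k x] that by simp
        show "eucl_norm (the (f j k i x) - the (realization a (\<Phi> k) x)) \<le> \<delta> * (1 + rpow (eucl_norm x) \<kappa>)"
          if "k \<in> {1..n j}" "x \<in> carrier_vec (D i j (k - 1))" for k x
          using \<Phi>(4)[OF that] .
        show "(\<Prod>l\<in>{k+1..n j}. L (i, j, l)) *
            epow (Max ({H (i, j, l) \<delta> |l. 0 < l \<and> l < k} \<union> {1}) *
              (\<Prod>l\<in>{1..k-1}. max (G (i, j, l) \<delta>) 1)) \<kappa> \<le> ennreal ?c" if "k \<in> {1..n j}" for k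
          using amplification[OF ij that \<delta>] .
      qed (use x nj \<delta> assms(14) c(1) ge in auto)
      also have "\<dots> \<le> \<epsilon> * ?x"
      proof (rule mult_right_mono)
        show "n j * ?c * \<delta> * (2 * (2 * real (n j)) powr \<kappa>) \<le> \<epsilon>"
        proof (rule balanced_error[OF _ _ _ _ n_le[OF ij(2)] _ _ _ _ _ _ \<delta>_def])
          show "Q = c1 * 2 * 2 powr \<kappa> * c2 powr (\<kappa> + 1) * (?Da powr (\<kappa> + 1) * ?Dg) * ?Db"
            using ge(5) by (simp add: Q_def C_def eU)
        qed (use assms(14,18) \<epsilon> nj c(1,2) ge in simp_all)
      qed (use \<open>?x > 0\<close> in simp)
      \<comment> \<open>Multiplying by the weight cancels \<open>?x\<close>, the polynomial gathered
        from the unweighted layer errors.\<close>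
      finally show ?thesis
        using assms(29) \<open>?x > 0\<close> by (simp add: field_simps)
    qed
    ultimately show ?thesis by blast
  qed

  \<comment> \<open>Membership in the target approximation space\<close>
  have compose: "compose_upto (\<lambda>k. f j k i) (n j) \<in> C_space (D i j 0) (D i j (n j))"
    if "i \<in> I" "j \<in> J" for i j
    using f[OF that] assms(19) that by (intro compose_upto_C_space) auto
  show ?thesis
  proof (rule approx_space_infI[where m = "\<lambda>(i, j). D i j 0" and m' = "\<lambda>(i, j). D i j (n j)"])
    fix p assume "p \<in> I \<times> J"
    then show "(\<lambda>(i, j). D i j 0) p \<ge> 1 \<and> (\<lambda>(i, j). D i j (n j)) p \<ge> 1 \<and>
        (\<lambda>(i, j). compose_upto (\<lambda>k. f j k i) (n j)) p \<in>
          C_space ((\<lambda>(i, j). D i j 0) p) ((\<lambda>(i, j). D i j (n j)) p)"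
      using D_ge_1 compose by auto
  next
    fix p \<epsilon> assume "p \<in> I \<times> J" and \<epsilon>: "\<epsilon> \<in> {0<..(1::real)}"
    then obtain i j where p: "p = (i, j)" and ij: "i \<in> I" "j \<in> J"
      by blast
    show "\<exists>\<Phi>\<in>ANN. realization a \<Phi> \<in> C_space ((\<lambda>(i, j). D i j 0) p) ((\<lambda>(i, j). D i j (n j)) p) \<and>
        num_params \<Phi> \<le> K' * \<epsilon> powr (- (2 * r0 / (1 - \<rho>))) * dim_prod (dim_tensor d e p) (R @ S) \<and>
        (\<forall>x\<in>carrier_vec ((\<lambda>(i, j). D i j 0) p). w (eucl_norm x) * eucl_norm (the
          ((\<lambda>(i, j). compose_upto (\<lambda>k. f j k i) (n j)) p x) - the (realization a \<Phi> x)) \<le> \<epsilon>)"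
      unfolding p prod.case by (rule main[OF ij \<epsilon>])
  qed
qed

end
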